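(* Let $L$ be a positive definite even lattice generated by a screening system. Then $L$ has a $\mathbb Z$-basis consisting of screeners such that, with respect to it, $L$ is an orthogonal direct sum of lattices $\sqrt{p_i}\,K_i$, where each $p_i$ is a positive integer and each $K_i$ is one of the simply laced root lattices $A_n, D_n$ ($n\in\mathbb Z_{>0}$), $E_6,E_7,E_8$.
   Context: A positive definite even lattice $L$ is a finitely generated free abelian group with a $\mathbb Z$-valued positive definite symmetric bilinear form $\langle\cdot,\cdot\rangle$ such that $\langle\alpha,\alpha\rangle\in2\mathbb Z$ for all $\alpha\in L$. Put $L^\circ=\{\beta\in\mathbb Q\otimes L:\langle\alpha,\beta\rangle\in\mathbb Z\ \forall\alpha\in L\}$. The set of screeners of $L$ is $\Phi=\{\beta\in L: \beta\notin 2L,\ 2\beta/\langle\beta,\beta\rangle\in L^\circ\}$. A screening system is a linearly independent subset of $\Phi$ (inside $\mathbb C\otimes_{\mathbb Z}L$); $L$ is generated by a screening system if some screening system generates $L$ as an abelian group. $\sqrt p\,K$ denotes $K$ with its form multiplied by $p$; simply laced root lattices are normalized so that roots satisfy $\langle\alpha,\alpha\rangle=2$. "With respect to it" means that the basis is a disjoint union of bases of the orthogonal summands. *)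

theory Defs
  imports Complex_Main "HOL-Library.FuncSet" "HOL-Library.Disjoint_Sets"
    "HOL-Library.Poly_Mapping"
begin

section \<open>Abelian groups as \<open>\<int>\<close>-modules\<close>

definition int_scale :: "int \<Rightarrow> 'a::ab_group_add \<Rightarrow> 'a" where
  "int_scale n x = (if 0 \<le> n then ((+) x ^^ nat n) 0 else - ((+) x ^^ nat (- n)) 0)"

lemma funpow_plus_add:
  "((+) x ^^ (m + n)) (0::'a::ab_group_add) = ((+) x ^^ m) 0 + ((+) x ^^ n) 0"
  by (induction m) (simp_all add: add.assoc)

lemma int_scale_of_nat_diff:
  "int_scale (int m - int n) x = ((+) x ^^ m) 0 - ((+) x ^^ n) 0"
proof (cases "n \<le> m")
  case True
  then obtain k where "m = n + k" using le_Suc_ex by blast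
  then show ?thesis by (simp add: int_scale_def funpow_plus_add)
next
  case False
  then obtain k where k: "n = m + k" "k > 0" using less_imp_add_positive not_le by blast
  then show ?thesis by (simp add: int_scale_def funpow_plus_add)
qed

lemma int_scale_add_left: "int_scale (a + b) x = int_scale a x + int_scale b x"
proof -
  obtain m n k l where "a = int m - int n" "b = int k - int l"
    by (metis int_diff_cases)
  moreover from this have "a + b = int (m + k) - int (n + l)" by simp
  ultimately show ?thesis
    by (simp only: int_scale_of_nat_diff funpow_plus_add) (simp add: algebra_simps)
qed

lemma funpow_plus_add_right:
  "((+) (x + y) ^^ n) (0::'a::ab_group_add) = ((+) x ^^ n) 0 + ((+) y ^^ n) 0"
  by (induction n) (simp_all add: algebra_simps)

lemma int_scale_add_right: "int_scale a (x + y) = int_scale a x + int_scale a y"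
  by (simp add: int_scale_def funpow_plus_add_right)

lemma int_scale_1: "int_scale 1 x = x"
  by (simp add: int_scale_def)

lemma int_scale_0: "int_scale 0 x = 0"
  by (simp add: int_scale_def)

lemma int_scale_minus_left: "int_scale (- a) x = - int_scale a x"
  by (metis add.right_inverse add_eq_0_iff int_scale_0 int_scale_add_left)

lemma int_scale_mult_nat: "int_scale (int n * b) x = int_scale (int n) (int_scale b x)"
proof (induction n)
  case 0
  show ?case by (simp add: int_scale_0)
next
  case (Suc n)
  have "int (Suc n) * b = b + int n * b" by (simp add: algebra_simps)
  then show ?case
    using Suc by (simp add: int_scale_add_left int_scale_1)
qed

global_interpretation zmod: module "int_scale :: int \<Rightarrow> 'a::ab_group_add \<Rightarrow> 'a"
proof
  fix a b :: int and x y :: 'a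
  show "int_scale a (x + y) = int_scale a x + int_scale a y" by (rule int_scale_add_right)
  show "int_scale (a + b) x = int_scale a x + int_scale b x" by (rule int_scale_add_left)
  show "int_scale 1 x = x" by (rule int_scale_1)
  show "int_scale a (int_scale b x) = int_scale (a * b) x"
  proof (cases "0 \<le> a")
    case True
    then show ?thesis using int_scale_mult_nat[of "nat a" b x] by simp
  next
    case False
    then have "int_scale (- a * b) x = int_scale (- a) (int_scale b x)"
      using int_scale_mult_nat[of "nat (- a)" b x] by simp
    then show ?thesis by (simp add: int_scale_minus_left)
  qed
qed

definition z_basis :: "'a::ab_group_add set \<Rightarrow> 'a set \<Rightarrow> bool" where
  "z_basis B M \<longleftrightarrow> zmod.independent B \<and> zmod.span B = M"


section \<open>The tensor product \<open>F \<otimes>\<^sub>\<int> L\<close>\<close>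

text \<open>
  A list \<open>[(c\<^sub>1, a\<^sub>1), \<dots>]\<close> stands for the formal sum \<open>c\<^sub>1 \<otimes> a\<^sub>1 + \<dots>\<close>; lists are taken modulo
  the least congruence making \<open>\<otimes>\<close> additive in both arguments. Formal sums have no subtraction,
  hence the separate rule \<open>zero\<close>.
\<close>

inductive tensor_rel :: "('f::field \<times> 'a::ab_group_add) list \<Rightarrow> ('f \<times> 'a) list \<Rightarrow> bool" where
  refl: "tensor_rel xs xs"
| sym: "tensor_rel xs ys \<Longrightarrow> tensor_rel ys xs"
| trans: "tensor_rel xs ys \<Longrightarrow> tensor_rel ys zs \<Longrightarrow> tensor_rel xs zs"
| append: "tensor_rel xs xs' \<Longrightarrow> tensor_rel ys ys' \<Longrightarrow> tensor_rel (xs @ ys) (xs' @ ys')"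
| comm: "tensor_rel (xs @ ys) (ys @ xs)"
| add_left: "tensor_rel [(c + d, a)] [(c, a), (d, a)]"
| add_right: "tensor_rel [(c, a + b)] [(c, a), (c, b)]"
| zero: "tensor_rel [(0, a)] []"

quotient_type (overloaded) ('f, 'a) tensor = "('f::field \<times> 'a::ab_group_add) list" / tensor_rel
  by (rule equivpI) (auto simp: reflp_def symp_def transp_def
      intro: tensor_rel.refl tensor_rel.sym tensor_rel.trans)

lemma tensor_rel_scale:
  "tensor_rel xs ys \<Longrightarrow>
    tensor_rel (map (\<lambda>(d, a). (c * d, a)) xs) (map (\<lambda>(d, a). (c * d, a)) ys)"
  by (induction rule: tensor_rel.induct)
    (auto simp: distrib_left intro: tensor_rel.intros)

lift_definition tensor_scale :: "'f::field \<Rightarrow> ('f, 'a::ab_group_add) tensor \<Rightarrow> ('f, 'a) tensor"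
  is "\<lambda>c. map (\<lambda>(d, a). (c * d, a))"
  by (rule tensor_rel_scale)

lift_definition pure_tensor :: "'f::field \<Rightarrow> 'a::ab_group_add \<Rightarrow> ('f, 'a) tensor" (infix "\<otimes>\<^sub>\<int>" 75)
  is "\<lambda>c a. [(c, a)]" .

lemma tensor_rel_neg:
  "tensor_rel (map (\<lambda>(d, a). (- d, a)) xs @ xs) []"
proof (induction xs)
  case Nil
  show ?case by (simp add: tensor_rel.refl)
next
  case (Cons z xs)
  obtain d a where z: "z = (d, a)" by fastforce
  let ?n = "map (\<lambda>(d, a). (- d, a))"
  have 1: "tensor_rel ((?n [z] @ ?n xs) @ ([z] @ xs)) ((?n [z] @ [z]) @ (?n xs @ xs))"
    using tensor_rel.append[OF tensor_rel.append[OF tensor_rel.refl[of "?n [z]"]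
          tensor_rel.comm[of "?n xs" "[z]"]] tensor_rel.refl[of xs]]
    by simp
  have "tensor_rel (?n [z] @ [z]) [(- d + d, a)]"
    using tensor_rel.sym[OF tensor_rel.add_left[of "- d" d a]] by (simp add: z)
  moreover have "tensor_rel [(- d + d, a)] []"
    using tensor_rel.zero[of a] by simp
  ultimately have "tensor_rel (?n [z] @ [z]) []" by (rule tensor_rel.trans)
  from tensor_rel.append[OF this Cons.IH] have "tensor_rel ((?n [z] @ [z]) @ (?n xs @ xs)) []"
    by simp
  from tensor_rel.trans[OF 1 this] show ?case by simp
qed

instantiation tensor :: (field, ab_group_add) ab_group_add
begin

lift_definition zero_tensor :: "('a, 'b) tensor" is "[]" .

lift_definition plus_tensor :: "('a, 'b) tensor \<Rightarrow> ('a, 'b) tensor \<Rightarrow> ('a, 'b) tensor"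
  is "(@)" by (rule tensor_rel.append)

lift_definition uminus_tensor :: "('a, 'b) tensor \<Rightarrow> ('a, 'b) tensor"
  is "map (\<lambda>(d, a). (- d, a))"
  using tensor_rel_scale[where c = "- 1"] by simp

definition minus_tensor :: "('a, 'b) tensor \<Rightarrow> ('a, 'b) tensor \<Rightarrow> ('a, 'b) tensor" where
  "minus_tensor x y = x + - y"

instance
proof
  fix x y z :: "('a, 'b) tensor"
  show "x + y + z = x + (y + z)" by transfer (simp add: tensor_rel.refl)
  show "x + y = y + x" by transfer (rule tensor_rel.comm)
  show "0 + x = x" by transfer (simp add: tensor_rel.refl)
  show "- x + x = 0" by transfer (rule tensor_rel_neg)
  show "x - y = x + - y" by (rule minus_tensor_def)
qed

end

lemma tensor_rel_scale_add:
  "tensor_rel (map (\<lambda>(e, a). ((c + d) * e, a)) xs)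
    (map (\<lambda>(e, a). (c * e, a)) xs @ map (\<lambda>(e, a). (d * e, a)) xs)"
proof (induction xs)
  case Nil
  show ?case by (simp add: tensor_rel.refl)
next
  case (Cons z xs)
  obtain e a where z: "z = (e, a)" by fastforce
  let ?c = "map (\<lambda>(e, a). (c * e, a))" and ?d = "map (\<lambda>(e, a). (d * e, a))"
  have "tensor_rel [((c + d) * e, a)] (?c [z] @ ?d [z])"
    using tensor_rel.add_left[of "c * e" "d * e" a] by (simp add: z distrib_right)
  from tensor_rel.append[OF this Cons.IH]
  have 1: "tensor_rel (map (\<lambda>(e, a). ((c + d) * e, a)) (z # xs))
      ((?c [z] @ ?d [z]) @ (?c xs @ ?d xs))"
    by (simp add: z)
  have "tensor_rel ((?c [z] @ ?d [z]) @ (?c xs @ ?d xs)) ((?c [z] @ ?c xs) @ (?d [z] @ ?d xs))"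
    using tensor_rel.append[OF tensor_rel.append[OF tensor_rel.refl[of "?c [z]"]
          tensor_rel.comm[of "?d [z]" "?c xs"]] tensor_rel.refl[of "?d xs"]]
    by simp
  from tensor_rel.trans[OF 1 this] show ?case by simp
qed

global_interpretation tensor: vector_space
  "tensor_scale :: 'f::field \<Rightarrow> ('f, 'a::ab_group_add) tensor \<Rightarrow> _"
proof
  fix c d :: 'f and x y :: "('f, 'a) tensor"
  show "tensor_scale c (x + y) = tensor_scale c x + tensor_scale c y"
    by transfer (simp add: tensor_rel.refl)
  show "tensor_scale (c + d) x = tensor_scale c x + tensor_scale d x"
    by transfer (rule tensor_rel_scale_add)
  show "tensor_scale c (tensor_scale d x) = tensor_scale (c * d) x"
    by transfer (simp add: o_def case_prod_unfold mult.assoc tensor_rel.refl)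
  show "tensor_scale 1 x = x"
    by transfer (simp add: tensor_rel.refl)
qed


section \<open>Positive definite even lattices and screeners\<close>

text \<open>The lattice is the whole type \<open>'a\<close>.\<close>

locale pos_def_even_lattice =
  fixes form :: "'a::ab_group_add \<Rightarrow> 'a \<Rightarrow> int"
  assumes fin_gen_free: "\<exists>B :: 'a set. finite B \<and> z_basis B UNIV"
    and form_sym: "form x y = form y x"
    and form_add: "form (x + y) z = form x z + form y z"
    and form_pos: "x \<noteq> 0 \<Longrightarrow> form x x > 0"
    and form_even: "even (form x x)"

text \<open>
  The \<open>F\<close>-linear extension of an additive functional \<open>f\<close>, \<open>c \<otimes> a \<mapsto> c * f a\<close>. It does not
  exist for other \<open>f\<close>, where the value is \<open>0\<close> by convention.
\<close>

lift_definition extend_functional ::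
  "('a::ab_group_add \<Rightarrow> int) \<Rightarrow> ('f::field, 'a) tensor \<Rightarrow> 'f"
  is "\<lambda>f xs. if additive f then \<Sum>(c, a)\<leftarrow>xs. c * of_int (f a) else 0"
  subgoal premises prems for f xs ys
    using prems by (induction rule: tensor_rel.induct)
      (auto simp: additive.add algebra_simps split: if_splits)
  done

lemma extend_functional_pure:
  "additive f \<Longrightarrow> extend_functional f (c \<otimes>\<^sub>\<int> a) = c * of_int (f a)"
  by transfer simp

lemma extend_functional_add:
  "extend_functional f (x + y) = extend_functional f x + extend_functional f y"
  by transfer simp

definition dual_lattice :: "('a::ab_group_add \<Rightarrow> 'a \<Rightarrow> int) \<Rightarrow> (rat, 'a) tensor set" where
  "dual_lattice form = {\<beta>. \<forall>\<alpha>. extend_functional (form \<alpha>) \<beta> \<in> \<int>}"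

definition screeners :: "('a::ab_group_add \<Rightarrow> 'a \<Rightarrow> int) \<Rightarrow> 'a set" where
  "screeners form = {\<beta>. \<beta> \<notin> range (int_scale 2) \<and>
     tensor_scale (2 / of_int (form \<beta> \<beta>)) (1 \<otimes>\<^sub>\<int> \<beta>) \<in> dual_lattice form}"

definition screening_system :: "('a::ab_group_add \<Rightarrow> 'a \<Rightarrow> int) \<Rightarrow> 'a set \<Rightarrow> bool" where
  "screening_system form S \<longleftrightarrow>
     S \<subseteq> screeners form \<and> tensor.independent ((\<lambda>\<beta>. (1 :: complex) \<otimes>\<^sub>\<int> \<beta>) ` S)"


section \<open>Orthogonal sums and isometries\<close>

definition orthogonal_direct_sum ::
  "('a::ab_group_add \<Rightarrow> 'a \<Rightarrow> int) \<Rightarrow> 'i set \<Rightarrow> ('i \<Rightarrow> 'a set) \<Rightarrow> bool" where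
  "orthogonal_direct_sum form I M \<longleftrightarrow>
     (\<forall>i\<in>I. zmod.subspace (M i)) \<and>
     (\<forall>x. \<exists>!f. f \<in> Pi\<^sub>E I M \<and> x = (\<Sum>i\<in>I. f i)) \<and>
     (\<forall>i\<in>I. \<forall>j\<in>I. i \<noteq> j \<longrightarrow> (\<forall>x\<in>M i. \<forall>y\<in>M j. form x y = 0))"

definition lattice_isometric ::
  "'a::ab_group_add set \<Rightarrow> ('a \<Rightarrow> 'a \<Rightarrow> int) \<Rightarrow> 'b::ab_group_add set \<Rightarrow> ('b \<Rightarrow> 'b \<Rightarrow> int) \<Rightarrow> bool"
where
  "lattice_isometric M g N h \<longleftrightarrow>
     (\<exists>\<phi>. bij_betw \<phi> M N \<and>
          (\<forall>x\<in>M. \<forall>y\<in>M. \<phi> (x + y) = \<phi> x + \<phi> y) \<and>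
          (\<forall>x\<in>M. \<forall>y\<in>M. h (\<phi> x) (\<phi> y) = g x y))"


section \<open>Simply laced root lattices\<close>

datatype dynkin_type = Dyn_A nat | Dyn_D nat | Dyn_E nat

definition ade_types :: "dynkin_type set" where
  "ade_types = {Dyn_A n | n. n > 0} \<union> {Dyn_D n | n. n > 0} \<union> {Dyn_E 6, Dyn_E 7, Dyn_E 8}"

fun dynkin_rank :: "dynkin_type \<Rightarrow> nat" where
  "dynkin_rank (Dyn_A n) = n"
| "dynkin_rank (Dyn_D n) = n"
| "dynkin_rank (Dyn_E n) = n"

text \<open>
  The diagrams \<open>D\<^sub>n\<close> and \<open>E\<^sub>n\<close> consist of the path \<open>0, \<dots>, n - 2\<close> and the further node \<open>n - 1\<close>,
  which is joined to node \<open>n - 3\<close> (for \<open>D\<^sub>n\<close>, if \<open>n \<ge> 3\<close>) or node \<open>2\<close> (for \<open>E\<^sub>n\<close>). In low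
  rank this gives \<open>D\<^sub>1 = A\<^sub>1\<close>, \<open>D\<^sub>2 = A\<^sub>1 + A\<^sub>1\<close> and \<open>D\<^sub>3 = A\<^sub>3\<close>.
\<close>

fun dynkin_edges :: "dynkin_type \<Rightarrow> (nat \<times> nat) set" where
  "dynkin_edges (Dyn_A n) = {(i, i + 1) | i. i + 1 < n}"
| "dynkin_edges (Dyn_D n) = {(i, i + 1) | i. i + 2 < n} \<union> {(i, i + 2) | i. i + 3 = n}"
| "dynkin_edges (Dyn_E n) = {(i, i + 1) | i. i + 2 < n} \<union> {(2, n - 1)}"

definition cartan_matrix :: "dynkin_type \<Rightarrow> nat \<Rightarrow> nat \<Rightarrow> int" where
  "cartan_matrix t i j =
     (if i = j then 2
      else if (i, j) \<in> dynkin_edges t \<or> (j, i) \<in> dynkin_edges t then - 1 else 0)"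

text \<open>
  The root lattice is the free abelian group on the simple roots \<open>0, \<dots>, n - 1\<close>, whose Gram
  matrix is the Cartan matrix; in particular the simple roots, and hence all roots, have norm 2.
\<close>

definition root_lattice :: "dynkin_type \<Rightarrow> (nat \<Rightarrow>\<^sub>0 int) set" where
  "root_lattice t = {x. Poly_Mapping.keys x \<subseteq> {..<dynkin_rank t}}"

definition root_form :: "dynkin_type \<Rightarrow> (nat \<Rightarrow>\<^sub>0 int) \<Rightarrow> (nat \<Rightarrow>\<^sub>0 int) \<Rightarrow> int" where
  "root_form t x y = (\<Sum>i<dynkin_rank t. \<Sum>j<dynkin_rank t.
     Poly_Mapping.lookup x i * cartan_matrix t i j * Poly_Mapping.lookup y j)"

end

theory Submission
  imports Defs
begin

text \<open>
  If \<open>\<beta>, \<gamma>\<close> are non-orthogonal screeners of a basis and \<open>\<gamma>\<close> is longer, then replacing \<open>\<gamma>\<close> by its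
  shorter combination \<open>\<gamma> \<plusminus> \<beta>\<close>, which up to sign is the reflection of \<open>\<beta>\<close> in \<open>\<gamma>\<close> and has the norm
  of \<open>\<beta>\<close>, gives again a basis of screeners. Hence in a screener basis of minimal total norm,
  non-orthogonal elements have equal norm \<open>2p\<close> and product \<open>\<plusminus>p\<close>.

  A component is exhausted by adding one basis vector \<open>v\<close> at a time to a subset spanning a lattice
  with simple roots \<open>X\<close> of type \<open>ADE\<close>. Modulo the span of \<open>X\<close> one may take \<open>v\<close> antidominant, so that
  \<open>X \<union> {v}\<close> is again a simple system. The product of \<open>v\<close> with the highest root exceeds \<open>-2p\<close>,
  so \<open>v\<close> is joined to exactly one simple root, and that one has coefficient 1 in the highest root.
  Every such extended diagram is again of type \<open>ADE\<close> or contains an affine diagram \<open>E\<^sub>7\<close> or \<open>E\<^sub>8\<close>,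
  whose null vector contradicts positive definiteness.
\<close>

section \<open>Lattices and screeners\<close>

context pos_def_even_lattice
begin

lemma form_add_right: "form x (y + z) = form x y + form x z"
  by (metis form_add form_sym)

lemma form_zero_left [simp]: "form 0 x = 0"
  using form_add[of 0 0 x] by simp

lemma form_zero_right [simp]: "form x 0 = 0"
  by (simp add: form_sym[of x])

lemma form_minus_left: "form (- x) y = - form x y"
  using form_add[of x "- x" y] by simp

lemma form_minus_right: "form x (- y) = - form x y"
  by (metis form_minus_left form_sym)

lemma form_diff_left: "form (x - y) z = form x z - form y z"
  using form_add[of x "- y" z] by (simp add: form_minus_left)

lemma form_diff_right: "form x (y - z) = form x y - form x z"
  by (metis form_diff_left form_sym)

lemma form_scale_left: "form (int_scale n x) y = n * form x y"
proof (induction n rule: int_induct[where k = 0])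
  case base
  show ?case by (simp add: int_scale_0)
next
  case (step1 i)
  then show ?case
    by (simp add: int_scale_add_left int_scale_1 form_add algebra_simps)
next
  case (step2 i)
  then show ?case
    by (simp add: zmod.scale_left_diff_distrib int_scale_1 form_diff_left algebra_simps)
qed

lemma form_scale_right: "form x (int_scale n y) = n * form x y"
  by (metis form_scale_left form_sym)

lemma form_sum_left: "form (\<Sum>i\<in>A. f i) y = (\<Sum>i\<in>A. form (f i) y)"
  by (induction A rule: infinite_finite_induct) (simp_all add: form_add)

lemma form_sum_right: "form x (\<Sum>i\<in>A. f i) = (\<Sum>i\<in>A. form x (f i))"
  by (induction A rule: infinite_finite_induct) (simp_all add: form_add_right)

lemmas form_bilinear = form_add form_add_right form_diff_left form_diff_right
  form_minus_left form_minus_right form_scale_left form_scale_right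

lemma form_self_nonneg: "form x x \<ge> 0"
  using form_pos[of x] by (cases "x = 0") auto

lemma form_self_eq_0_iff [simp]: "form x x = 0 \<longleftrightarrow> x = 0"
  by (metis form_pos form_zero_left less_irrefl)

lemma orthogonal_span:
  assumes "\<And>x. x \<in> X \<Longrightarrow> form v x = 0" "y \<in> zmod.span X"
  shows "form v y = 0"
  using assms(2)
  by (induction rule: zmod.span_induct_alt) (simp_all add: form_bilinear assms(1))

lemma dvd_form_span:
  assumes "\<And>x. x \<in> X \<Longrightarrow> d dvd form v x" "y \<in> zmod.span X"
  shows "d dvd form v y"
  using assms(2)
  by (induction rule: zmod.span_induct_alt) (simp_all add: form_bilinear assms(1))

end

section \<open>Independence and spans over the integers\<close>

lemma zmod_independent_insertI:
  assumes "zmod.independent X" "\<And>a. int_scale a v \<in> zmod.span X \<Longrightarrow> a = 0"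
  shows "zmod.independent (insert v X)"
  unfolding zmod.independent_explicit_module
proof (intro allI impI)
  fix t u w
  assume t: "finite t" "t \<subseteq> insert v X" and sum: "(\<Sum>w\<in>t. int_scale (u w) w) = 0" and w: "w \<in> t"
  have *: "\<forall>w\<in>t - {v}. u w = 0" if "(\<Sum>w\<in>t - {v}. int_scale (u w) w) = 0"
    using assms(1)[unfolded zmod.independent_explicit_module] that t by blast
  show "u w = 0"
  proof (cases "v \<in> t")
    case True
    then have "int_scale (u v) v + (\<Sum>w\<in>t - {v}. int_scale (u w) w) = 0"
      using sum t by (simp add: sum.remove)
    \<comment> \<open>A relation involving \<open>v\<close> puts a multiple of \<open>v\<close> into
      the span of \<open>X\<close>. Its coefficient therefore vanishes, and a relation on
      \<open>X\<close> alone remains.\<close>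
    then have eq: "int_scale (u v) v = (\<Sum>w\<in>t - {v}. int_scale (- u w) w)"
      by (simp add: eq_neg_iff_add_eq_0 sum_negf)
    have "(\<Sum>w\<in>t - {v}. int_scale (- u w) w) \<in> zmod.span X"
      using t by (intro zmod.span_sum zmod.span_scale zmod.span_base) auto
    then have "u v = 0" using eq assms(2) by simp
    moreover from this have "(\<Sum>w\<in>t - {v}. int_scale (u w) w) = 0"
      using eq by (simp add: sum_negf)
    ultimately show ?thesis using * w by (cases "w = v") auto
  next
    case False
    then show ?thesis using * sum w by simp
  qed
qed

text \<open>Over the integers a multiple of \<open>v\<close> can lie in a span that does not contain
  \<open>v\<close>, so both directions of the criterion speak of all multiples.\<close>

lemma zmod_independent_insertD:
  assumes "zmod.independent (insert v X)" "v \<notin> X" "int_scale a v \<in> zmod.span X"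
  shows "a = 0"
proof -
  obtain t u where t: "finite t" "t \<subseteq> X" and eq: "int_scale a v = (\<Sum>w\<in>t. int_scale (u w) w)"
    using assms(3) unfolding zmod.span_explicit by blast
  have "v \<notin> t" using assms(2) t by blast
  let ?u = "u(v := - a)"
  have "(\<Sum>w\<in>t. int_scale (?u w) w) = (\<Sum>w\<in>t. int_scale (u w) w)"
    using \<open>v \<notin> t\<close> by (intro sum.cong) auto
  then have "(\<Sum>w\<in>insert v t. int_scale (?u w) w) = 0"
    using t \<open>v \<notin> t\<close> eq by simp
  moreover have "finite (insert v t)" "insert v t \<subseteq> insert v X" using t by auto
  ultimately have "?u v = 0"
    using assms(1) unfolding zmod.independent_explicit_module by blast
  then show ?thesis by simp
qed

text \<open>Only the coset of the new vector counts. This allows an antidominant representative of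
  \<open>v\<close>, or \<gamma> minus a multiple of \<beta> in place of \<gamma>.\<close>

lemma zmod_span_insert_cong:
  assumes "zmod.span X = zmod.span Y" "v' - v \<in> zmod.span Y"
  shows "zmod.span (insert v' X) = zmod.span (insert v Y)"
proof -
  have sub: "zmod.span (insert a P) \<subseteq> zmod.span (insert b Q)"
    if "zmod.span P = zmod.span Q" "a - b \<in> zmod.span Q" for a b and P Q :: "'a set"
  proof (rule zmod.span_minimal)
    have mono: "zmod.span Q \<subseteq> zmod.span (insert b Q)" by (rule zmod.span_mono) auto
    then have "a - b + b \<in> zmod.span (insert b Q)"
      using that(2) by (intro zmod.span_add[OF _ zmod.span_base]) blast+
    moreover have "P \<subseteq> zmod.span Q" using that(1) zmod.span_superset[of P] by simp
    ultimately show "insert a P \<subseteq> zmod.span (insert b Q)" using mono by auto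
  qed auto
  have "v - v' \<in> zmod.span X" using zmod.span_neg[OF assms(2)] assms(1) by simp
  then show ?thesis using sub[OF assms] sub[OF assms(1)[symmetric]] by blast
qed

text \<open>If \<open>s\<close> were twice a vector, its coefficient in itself would be even, but it
  is 1. This settles the condition on 2L for every new basis vector.\<close>

lemma basis_not_even:
  assumes "z_basis S UNIV" "s \<in> S"
  shows "s \<notin> range (int_scale 2)"
proof
  assume "s \<in> range (int_scale 2)"
  then obtain x where x: "s = int_scale 2 x" by blast
  have "x \<in> zmod.span (insert s (S - {s}))"
    using assms by (simp add: z_basis_def insert_absorb)
  then obtain a where a: "x - int_scale a s \<in> zmod.span (S - {s})"
    using zmod.span_breakdown[of s "insert s (S - {s})" x] by auto
  have "int_scale (1 - 2 * a) s = int_scale 2 (x - int_scale a s)"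
    by (simp add: x zmod.scale_left_diff_distrib zmod.scale_right_diff_distrib int_scale_1)
  then have "int_scale (1 - 2 * a) s \<in> zmod.span (S - {s})" using a zmod.span_scale by metis
  moreover have "zmod.independent (insert s (S - {s}))"
    using assms by (simp add: z_basis_def insert_absorb)
  ultimately have "1 - 2 * a = 0" using zmod_independent_insertD[of s "S - {s}"] by blast
  then show False by presburger
qed

section \<open>Screeners as a divisibility condition\<close>

context pos_def_even_lattice
begin

lemma tensor_scale_pure: "tensor_scale c (d \<otimes>\<^sub>\<int> a) = (c * d) \<otimes>\<^sub>\<int> a"
  by transfer (simp add: tensor_rel.refl)

lemma additive_form: "additive (form \<alpha>)"
  by unfold_locales (simp add: form_add_right)

text \<open>Clearing the denominator turns membership in the dual lattice into divisibility of
  integers, the form in which the rest of the proof uses screeners.\<close>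

lemma screeners_iff:
  "\<beta> \<in> screeners form \<longleftrightarrow> \<beta> \<notin> range (int_scale 2) \<and> (\<forall>\<alpha>. form \<beta> \<beta> dvd 2 * form \<alpha> \<beta>)"
proof (cases "\<beta> = 0")
  case True
  \<comment> \<open>For \<beta> = 0 the factor 2/0 is 0 by convention, but 0 lies in 2L, so both
    sides are false.\<close>
  have "(0::'a) \<in> range (int_scale 2)" by (metis rangeI zmod.scale_zero_right)
  then show ?thesis using True by (simp add: screeners_def)
next
  case False
  then have n: "form \<beta> \<beta> \<noteq> 0" by simp
  have "(2 / rat_of_int (form \<beta> \<beta>) * 1 * of_int (form \<alpha> \<beta>) \<in> \<int>) \<longleftrightarrow> form \<beta> \<beta> dvd 2 * form \<alpha> \<beta>" for \<alpha>
  proof -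
    have "2 / rat_of_int (form \<beta> \<beta>) * 1 * of_int (form \<alpha> \<beta>)
        = of_int (2 * form \<alpha> \<beta>) / of_int (form \<beta> \<beta>)" by simp
    then show ?thesis using n by (simp only: of_int_div_of_int_in_Ints_iff) simp
  qed
  then show ?thesis
    by (simp add: screeners_def dual_lattice_def tensor_scale_pure
        extend_functional_pure[OF additive_form])
qed

text \<open>Pairing with each \<alpha> recovers the integer \<open>form \<alpha> \<beta>\<close>,
  since the integers embed in a field of characteristic 0. Nondegeneracy of the form does the
  rest.\<close>

lemma pure_tensor_inj:
  fixes \<beta> \<gamma> :: 'a
  assumes "(1 :: 'f::field_char_0) \<otimes>\<^sub>\<int> \<beta> = 1 \<otimes>\<^sub>\<int> \<gamma>"
  shows "\<beta> = \<gamma>"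
proof -
  have "form \<alpha> \<beta> = form \<alpha> \<gamma>" for \<alpha>
    using arg_cong[OF assms, of "extend_functional (form \<alpha>)"]
    by (simp add: extend_functional_pure[OF additive_form])
  then have "form (\<beta> - \<gamma>) (\<beta> - \<gamma>) = 0" by (simp add: form_diff_right)
  then show ?thesis by simp
qed

end

section \<open>Integral independence of a screening system\<close>

lemma pure_tensor_add: "c \<otimes>\<^sub>\<int> (a + b) = c \<otimes>\<^sub>\<int> a + c \<otimes>\<^sub>\<int> b"
  by transfer (simp add: tensor_rel.add_right)

lemma pure_tensor_zero: "c \<otimes>\<^sub>\<int> 0 = 0"
  using pure_tensor_add[of c 0 0] by simp

lemma pure_tensor_int_scale:
  fixes a :: "'a::ab_group_add"
  shows "c \<otimes>\<^sub>\<int> (int_scale n a) = tensor_scale (of_int n) (c \<otimes>\<^sub>\<int> a)"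
proof -
  have minus: "c \<otimes>\<^sub>\<int> (x - y) = c \<otimes>\<^sub>\<int> x - c \<otimes>\<^sub>\<int> y" for x y :: 'a
    using pure_tensor_add[of c "x - y" y] by simp
  show ?thesis
  proof (induction n rule: int_induct[where k = 0])
    case base
    show ?case by (simp add: int_scale_0 pure_tensor_zero)
  next
    case (step1 i)
    then show ?case
      by (simp add: int_scale_add_left int_scale_1 pure_tensor_add tensor.scale_left_distrib)
  next
    case (step2 i)
    then show ?case
      by (simp add: zmod.scale_left_diff_distrib int_scale_1 minus tensor.scale_left_diff_distrib)
  qed
qed

lemma pure_tensor_sum: "c \<otimes>\<^sub>\<int> (\<Sum>i\<in>A. f i) = (\<Sum>i\<in>A. c \<otimes>\<^sub>\<int> f i)"
  by (induction A rule: infinite_finite_induct) (simp_all add: pure_tensor_add pure_tensor_zero)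

context pos_def_even_lattice
begin

lemma screening_system_independent:
  assumes "screening_system form S"
  shows "zmod.independent S"
  unfolding zmod.independent_explicit_module
proof (intro allI impI)
  fix t u w
  assume t: "finite t" "t \<subseteq> S" and sum: "(\<Sum>w\<in>t. int_scale (u w) w) = 0" and w: "w \<in> t"
  let ?e = "\<lambda>\<beta>::'a. (1::complex) \<otimes>\<^sub>\<int> \<beta>"
  \<comment> \<open>Independence in the tensor product concerns the image set, so the integer
    coefficients are carried there along the injection \<open>?e\<close>.\<close>
  let ?u = "\<lambda>x. complex_of_int (u (inv_into t ?e x))"
  have inj: "inj_on ?e t" using pure_tensor_inj by (auto intro: inj_onI)
  have "(\<Sum>x\<in>?e ` t. tensor_scale (?u x) x) = (\<Sum>w\<in>t. ?e (int_scale (u w) w))"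
    by (simp add: sum.reindex[OF inj] inv_into_f_f[OF inj] pure_tensor_int_scale)
  also have "\<dots> = 0" using sum by (simp add: pure_tensor_sum[symmetric] pure_tensor_zero)
  finally have "?u (?e w) = 0"
    using assms t w tensor.independentD[of "?e ` S" "?e ` t" ?u "?e w"]
    by (simp add: screening_system_def image_mono)
  then show "u w = 0" using inv_into_f_f[OF inj w] by simp
qed

text \<open>Each element of a finite basis \<open>B\<close> involves finitely many elements of
  \<open>S\<close>. Together these already generate the lattice, and independence leaves no room for
  further elements of \<open>S\<close>.\<close>

lemma z_basis_finite:
  assumes "z_basis S (UNIV :: 'a set)"
  shows "finite S"
proof -
  obtain B :: "'a set" where B: "finite B" "z_basis B UNIV" using fin_gen_free by blast
  have "\<forall>b\<in>B. \<exists>t. finite t \<and> t \<subseteq> S \<and> b \<in> zmod.span t"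
  proof
    fix b assume "b \<in> B"
    have "b \<in> zmod.span S" using assms by (simp add: z_basis_def)
    then obtain t u where t: "finite t" "t \<subseteq> S" "b = (\<Sum>w\<in>t. int_scale (u w) w)"
      unfolding zmod.span_explicit by blast
    have "b \<in> zmod.span t" unfolding t(3)
      by (intro zmod.span_sum zmod.span_scale zmod.span_base)
    then show "\<exists>t. finite t \<and> t \<subseteq> S \<and> b \<in> zmod.span t" using t by blast
  qed
  then obtain t where t: "\<And>b. b \<in> B \<Longrightarrow> finite (t b) \<and> t b \<subseteq> S \<and> b \<in> zmod.span (t b)"
    by metis
  let ?F = "\<Union>b\<in>B. t b"
  have "B \<subseteq> zmod.span ?F"
  proof
    fix b assume b: "b \<in> B"
    then have "zmod.span (t b) \<subseteq> zmod.span ?F" by (intro zmod.span_mono) auto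
    then show "b \<in> zmod.span ?F" using t b by blast
  qed
  then have F: "zmod.span ?F = UNIV"
    using B zmod.span_minimal[of B "zmod.span ?F"] by (auto simp: z_basis_def)
  have "S \<subseteq> ?F"
  proof
    fix s assume s: "s \<in> S"
    show "s \<in> ?F"
    proof (rule ccontr)
      assume "s \<notin> ?F"
      then have "?F \<subseteq> S - {s}" using t by blast
      then have "s \<in> zmod.span (S - {s})" using F zmod.span_mono by blast
      moreover have "zmod.independent (insert s (S - {s}))"
        using assms s by (simp add: z_basis_def insert_absorb)
      ultimately show False
        using zmod_independent_insertD[of s "S - {s}" 1] by (simp add: int_scale_1)
    qed
  qed
  moreover have "finite ?F" using B t by blast
  ultimately show ?thesis by (rule finite_subset)
qed

end

section \<open>Simple systems of type ADE\<close>

lemma image_append: "(c(m := v)) ` {..<Suc m} = insert v (c ` {..<m::nat})"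
proof -
  have "(c(m := v)) ` {..<m} = c ` {..<m}" by (intro image_cong) auto
  then show ?thesis by (simp only: lessThan_Suc image_insert fun_upd_same)
qed

context pos_def_even_lattice
begin

text \<open>The Gram matrix is \<open>p\<close> times the Cartan matrix of
  \<open>A_m\<close>.\<close>

definition path_system :: "int \<Rightarrow> nat \<Rightarrow> (nat \<Rightarrow> 'a) \<Rightarrow> bool" where
  "path_system p m c \<longleftrightarrow> (\<forall>i<m. \<forall>k<m. form (c i) (c k) =
     (if i = k then 2 * p else if k = Suc i \<or> i = Suc k then - p else 0))"

definition branch_system :: "int \<Rightarrow> nat \<Rightarrow> nat \<Rightarrow> (nat \<Rightarrow> 'a) \<Rightarrow> 'a \<Rightarrow> bool" where
  "branch_system p m j c e \<longleftrightarrow> path_system p m c \<and> j < m \<and> form e e = 2 * p \<and>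
     (\<forall>i<m. form (c i) e = (if i = j then - p else 0))"

text \<open>Besides paths \<open>A\<^sub>m\<close>, a path of length \<open>m\<close> with a further root attached to node \<open>j\<close>
  (nodes numbered from 0): \<open>D\<close> of rank \<open>m + 1\<close> for \<open>j = m - 2\<close>, \<open>E\<close> of rank \<open>m + 1\<close> for \<open>j = 2\<close>.
  Norms are \<open>2 * p\<close>.\<close>

definition ade_system :: "int \<Rightarrow> 'a set \<Rightarrow> bool" where
  "ade_system p X \<longleftrightarrow>
     (\<exists>m c. 0 < m \<and> path_system p m c \<and> X = c ` {..<m}) \<or>
     (\<exists>m j c e. branch_system p m j c e \<and> X = insert e (c ` {..<m}) \<and>
        (3 \<le> m \<and> j = m - 2 \<or> j = 2 \<and> m \<in> {5, 6, 7}))"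

lemma ade_system_pathI:
  "path_system p m c \<Longrightarrow> 0 < m \<Longrightarrow> X = c ` {..<m} \<Longrightarrow> ade_system p X"
  unfolding ade_system_def by blast

lemma ade_system_branchI:
  "branch_system p m j c e \<Longrightarrow> X = insert e (c ` {..<m}) \<Longrightarrow>
    3 \<le> m \<and> j = m - 2 \<or> j = 2 \<and> m \<in> {5, 6, 7} \<Longrightarrow> ade_system p X"
  unfolding ade_system_def by blast

text \<open>By induction on \<open>m\<close>, since a new root meets only its predecessor. The
  truncated \<open>m - 1\<close> leaves both sums empty for \<open>m = 0\<close>.\<close>

lemma path_norm:
  assumes "path_system p m c"
  shows "form (\<Sum>i<m. int_scale (w i) (c i)) (\<Sum>i<m. int_scale (w i) (c i)) =
    p * ((\<Sum>i<m. 2 * (w i)\<^sup>2) - (\<Sum>i<m - 1. 2 * w i * w (Suc i)))"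
  using assms
proof (induction m)
  case 0
  show ?case by simp
next
  case (Suc m)
  let ?A = "\<Sum>i<m. int_scale (w i) (c i)"
  have path: "path_system p m c" using Suc.prems by (simp add: path_system_def)
  have "form ?A (c m) = (\<Sum>i<m. w i * form (c i) (c m))"
    by (simp add: form_sum_left form_scale_left)
  also have "\<dots> = (\<Sum>i<m. if m = Suc i then - p * w i else 0)"
    using Suc.prems by (intro sum.cong refl) (auto simp: path_system_def)
  also have "\<dots> = (if m = 0 then 0 else - p * w (m - 1))"
    by (cases m) (simp_all add: sum.delta)
  finally have A: "form ?A (c m) = (if m = 0 then 0 else - p * w (m - 1))" .
  have "form (c m) (c m) = 2 * p" using Suc.prems by (simp add: path_system_def)
  then have "form (?A + int_scale (w m) (c m)) (?A + int_scale (w m) (c m))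
      = form ?A ?A + 2 * w m * form ?A (c m) + 2 * p * (w m)\<^sup>2"
    using form_sym[of "c m" ?A] by (simp add: form_bilinear power2_eq_square algebra_simps)
  then show ?case
    unfolding A Suc.IH[OF path] by (cases m) (simp_all add: algebra_simps power2_eq_square)
qed

text \<open>The root \<open>e\<close> adds its own norm and one cross term with node
  \<open>j\<close>. The bracket is later evaluated to 2 for highest roots and to 0 for null vectors
  of affine diagrams.\<close>

lemma branch_norm:
  assumes "branch_system p m j c e"
    and "\<theta> = (\<Sum>i<m. int_scale (w i) (c i)) + int_scale s e"
  shows "form \<theta> \<theta> =
    p * ((\<Sum>i<m. 2 * (w i)\<^sup>2) - (\<Sum>i<m - 1. 2 * w i * w (Suc i)) + 2 * s\<^sup>2 - 2 * s * w j)"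
proof -
  let ?A = "\<Sum>i<m. int_scale (w i) (c i)"
  have "form ?A e = (\<Sum>i<m. w i * form (c i) e)"
    by (simp add: form_sum_left form_scale_left)
  also have "\<dots> = (\<Sum>i<m. if i = j then - p * w i else 0)"
    using assms by (intro sum.cong refl) (auto simp: branch_system_def)
  also have "\<dots> = - p * w j" using assms by (simp add: branch_system_def)
  finally have "form ?A e = - p * w j" .
  moreover have "form \<theta> \<theta> = form ?A ?A + 2 * s * form ?A e + s\<^sup>2 * form e e"
    using assms(2) form_sym[of e ?A] by (simp add: form_bilinear power2_eq_square algebra_simps)
  moreover have "form ?A ?A = p * ((\<Sum>i<m. 2 * (w i)\<^sup>2) - (\<Sum>i<m - 1. 2 * w i * w (Suc i)))"
    using path_norm assms by (auto simp: branch_system_def)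
  moreover have "form e e = 2 * p" using assms by (simp add: branch_system_def)
  ultimately show ?thesis by (simp add: algebra_simps)
qed

section \<open>Reversing, cutting and prolonging diagrams\<close>

lemma path_systemD:
  "path_system p m c \<Longrightarrow> i < m \<Longrightarrow> k < m \<Longrightarrow>
    form (c i) (c k) = (if i = k then 2 * p else if k = Suc i \<or> i = Suc k then - p else 0)"
  unfolding path_system_def by blast

lemma branch_systemD:
  assumes "branch_system p m j c e"
  shows "path_system p m c" "j < m" "form e e = 2 * p"
    "i < m \<Longrightarrow> form (c i) e = (if i = j then - p else 0)"
    "i < m \<Longrightarrow> form e (c i) = (if i = j then - p else 0)"
  using assms form_sym[of e "c i"] unfolding branch_system_def by simp_all

lemma path_system_rev:
  assumes "path_system p m c"
  shows "path_system p m (\<lambda>i. c (m - Suc i))"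
  unfolding path_system_def
proof (intro allI impI)
  fix i k
  assume "i < m" "k < m"
  moreover from this have "m - Suc i = m - Suc k \<longleftrightarrow> i = k" "m - Suc k = Suc (m - Suc i) \<longleftrightarrow> i = Suc k"
    "m - Suc i = Suc (m - Suc k) \<longleftrightarrow> k = Suc i"
    by linarith+
  ultimately show "form (c (m - Suc i)) (c (m - Suc k)) =
      (if i = k then 2 * p else if k = Suc i \<or> i = Suc k then - p else 0)"
    using path_systemD[OF assms, of "m - Suc i" "m - Suc k"] by auto
qed

text \<open>Reading the path backwards reduces each case distinction to one end of the path.\<close>

lemma branch_system_rev:
  assumes "branch_system p m j c e"
  shows "branch_system p m (m - Suc j) (\<lambda>i. c (m - Suc i)) e"
proof -
  have "form (c (m - Suc i)) e = (if i = m - Suc j then - p else 0)" if "i < m" for i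
  proof -
    have "m - Suc i = j \<longleftrightarrow> i = m - Suc j" using that branch_systemD(2)[OF assms] by linarith
    then show ?thesis using branch_systemD(4)[OF assms, of "m - Suc i"] that by simp
  qed
  then show ?thesis
    using branch_systemD[OF assms] by (simp add: branch_system_def path_system_rev)
qed

lemma image_rev: "(\<lambda>i. c (m - Suc i)) ` {..<m} = c ` {..<m::nat}"
proof -
  have "i \<in> (\<lambda>i. m - Suc i) ` {..<m}" if "i < m" for i
    using that by (intro image_eqI[of _ _ "m - Suc i"]) auto
  then have "(\<lambda>i. m - Suc i) ` {..<m} = {..<m}" by auto
  moreover have "(\<lambda>i. c (m - Suc i)) ` {..<m} = c ` (\<lambda>i. m - Suc i) ` {..<m}"
    by (simp only: image_image)
  ultimately show ?thesis by (simp only:)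
qed

text \<open>A window of consecutive nodes around the branch node, used to cut affine diagrams out of
  longer ones.\<close>

lemma branch_system_shift:
  assumes "branch_system p m j c e" "a \<le> j" "j < a + n" "a + n \<le> m"
  shows "branch_system p n (j - a) (\<lambda>i. c (a + i)) e"
proof -
  have "path_system p n (\<lambda>i. c (a + i))"
    using branch_systemD(1)[OF assms(1)] assms(4) unfolding path_system_def by simp
  moreover have "form (c (a + i)) e = (if i = j - a then - p else 0)" if "i < n" for i
    using branch_systemD(4)[OF assms(1), of "a + i"] assms that by auto
  ultimately show ?thesis
    using branch_systemD(3)[OF assms(1)] assms by (simp add: branch_system_def)
qed

lemma path_system_append:
  assumes "path_system p m c" "form v v = 2 * p"
    and "\<And>i. i < m \<Longrightarrow> form v (c i) = (if i = m - 1 then - p else 0)"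
  shows "path_system p (Suc m) (c(m := v))"
  unfolding path_system_def
proof (intro allI impI)
  fix i k
  assume "i < Suc m" "k < Suc m"
  moreover have "form (c i) v = (if i = m - 1 then - p else 0)" if "i < m" for i
    using assms(3)[OF that] form_sym[of v "c i"] by simp
  ultimately show "form ((c(m := v)) i) ((c(m := v)) k) =
      (if i = k then 2 * p else if k = Suc i \<or> i = Suc k then - p else 0)"
    using path_systemD[OF assms(1), of i k] assms(2,3) by (auto simp: less_Suc_eq)
qed

lemma branch_system_append:
  assumes "branch_system p m j c e" "form v v = 2 * p" "form v e = 0"
    and "\<And>i. i < m \<Longrightarrow> form v (c i) = (if i = m - 1 then - p else 0)"
  shows "branch_system p (Suc m) j (c(m := v)) e"
  using branch_systemD[OF assms(1)] path_system_append[OF _ assms(2,4)] assms(3)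
  by (auto simp: branch_system_def less_Suc_eq)

section \<open>Exclusion of affine diagrams and classification of branch diagrams\<close>

lemma branch_fork_notin:
  assumes "branch_system p m j c e" "0 < p"
  shows "e \<notin> c ` {..<m}"
proof
  assume "e \<in> c ` {..<m}"
  then obtain i where "i < m" "e = c i" by auto
  then show False
    using branch_systemD(3)[OF assms(1)] branch_systemD(4)[OF assms(1), of i] assms(2)
    by (simp split: if_splits)
qed

text \<open>By positive definiteness a combination of norm 0 is the zero vector. With a nonzero
  coefficient at \<open>e\<close> it would be a relation among independent roots.\<close>

lemma branch_no_null:
  assumes "branch_system p m j c e" "0 < p"
    and "zmod.independent (insert e (c ` {..<m}))" "s \<noteq> 0"
    and "(\<Sum>i<m. 2 * (w i)\<^sup>2) - (\<Sum>i<m - 1. 2 * w i * w (Suc i)) + 2 * s\<^sup>2 - 2 * s * w j = (0::int)"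
  shows False
proof -
  let ?A = "\<Sum>i<m. int_scale (w i) (c i)"
  have "form (?A + int_scale s e) (?A + int_scale s e) = 0"
    using branch_norm[OF assms(1) HOL.refl, of w s] assms(5) by simp
  then have "int_scale s e = - ?A" by (simp add: add_eq_0_iff)
  moreover have "?A \<in> zmod.span (c ` {..<m})"
    by (intro zmod.span_sum zmod.span_scale zmod.span_base) auto
  ultimately have "int_scale s e \<in> zmod.span (c ` {..<m})" using zmod.span_neg by metis
  then show False
    using zmod_independent_insertD[OF assms(3) branch_fork_notin[OF assms(1,2)]] assms(4) by blast
qed

text \<open>The two null vectors are the imaginary roots of the affine diagrams \<open>E\<^sub>8\<close> and \<open>E\<^sub>7\<close>.\<close>

lemma branch_no_affine_E8:
  assumes "branch_system p m 2 c e" "0 < p" "8 \<le> m"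
    and "zmod.independent (insert e (c ` {..<m}))"
  shows False
proof -
  \<comment> \<open>The arms at node 2 of this window have 2, 5 and 1 nodes, as in affine
    \<open>E_8\<close>.\<close>
  have b: "branch_system p 8 2 c e" using branch_system_shift[OF assms(1), of 0 8] assms(3) by simp
  have "zmod.independent (insert e (c ` {..<8}))"
    using assms(3) by (intro zmod.independent_mono[OF assms(4)] insert_mono image_mono) auto
  from branch_no_null[OF b assms(2) this, of 3 "\<lambda>i. [2, 4, 6, 5, 4, 3, 2, 1] ! i"]
  show False by (simp add: numeral_eq_Suc)
qed

lemma branch_no_affine_E7:
  assumes "branch_system p m j c e" "0 < p" "3 \<le> j" "j + 4 \<le> m"
    and "zmod.independent (insert e (c ` {..<m}))"
  shows False
proof -
  \<comment> \<open>The window is centred at the branch node and has arms of 3, 3 and 1 nodes, as in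
    affine \<open>E_7\<close>.\<close>
  have b: "branch_system p 7 3 (\<lambda>i. c (j - 3 + i)) e"
    using branch_system_shift[OF assms(1), of "j - 3" 7] assms(3,4) by simp
  have "zmod.independent (insert e ((\<lambda>i. c (j - 3 + i)) ` {..<7}))"
    using assms(3,4) by (intro zmod.independent_mono[OF assms(5)] insert_mono) auto
  from branch_no_null[OF b assms(2) this, of 2 "\<lambda>i. [1, 2, 3, 4, 3, 2, 1] ! i"]
  show False by (simp add: numeral_eq_Suc)
qed

text \<open>One arm is \<open>e\<close> alone, so the distance from \<open>j\<close> to the nearer
  end of the path decides: 0 gives type A, 1 gives D, and 2 gives E unless affine \<open>E_8\<close>
  is contained. From distance 3 on, affine \<open>E_7\<close> is contained.\<close>

lemma branch_system_ade:
  assumes "branch_system p m j c e" "0 < p"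
    and "zmod.independent (insert e (c ` {..<m}))"
  shows "ade_system p (insert e (c ` {..<m}))"
proof -
  have end_case: "ade_system p (insert e (c ` {..<m}))" if b: "branch_system p m (m - 1) c e" for c
  proof (rule ade_system_pathI)
    show "path_system p (Suc m) (c(m := e))"
      using path_system_append[OF branch_systemD(1,3)[OF b] branch_systemD(5)[OF b]] .
    show "insert e (c ` {..<m}) = (c(m := e)) ` {..<Suc m}" by (rule image_append[symmetric])
  qed simp
  have two_case: "ade_system p (insert e (c ` {..<m}))"
    if b: "branch_system p m 2 c e" and m: "5 \<le> m" and i: "zmod.independent (insert e (c ` {..<m}))" for c
  proof -
    have "m < 8" using branch_no_affine_E8[OF b assms(2) _ i] by force
    then have "m \<in> {5, 6, 7}" using m by auto
    then show ?thesis using ade_system_branchI[OF b] by blast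
  qed
  let ?c = "\<lambda>i. c (m - Suc i)"
  have j: "j < m" using assms(1) by (simp add: branch_system_def)
  note rev = branch_system_rev[OF assms(1)]
  have im: "?c ` {..<m} = c ` {..<m}" by (rule image_rev)
  \<comment> \<open>Reversal exchanges the first six cases in pairs; the last one is
    symmetric.\<close>
  consider "j = m - 1" | "j = 0" | "3 \<le> m" "j = m - 2" | "3 \<le> m" "j = 1"
    | "5 \<le> m" "j = 2" | "5 \<le> m" "j = m - 3" | "3 \<le> j" "j + 4 \<le> m"
    using j by linarith
  then show ?thesis
  proof cases
    case 1
    then show ?thesis using end_case assms(1) by simp
  next
    case 2
    then show ?thesis using end_case[of ?c] rev im by simp
  next
    case 3
    then show ?thesis using ade_system_branchI[OF assms(1) HOL.refl] by simp
  next
    case 4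
    then show ?thesis using ade_system_branchI[OF rev HOL.refl] im by (simp add: numeral_2_eq_2)
  next
    case 5
    then show ?thesis using two_case assms by simp
  next
    case 6
    then have "m - Suc j = 2" by simp
    then show ?thesis using two_case[of ?c] 6 rev im assms(3) by simp
  next
    case 7
    then show ?thesis using branch_no_affine_E7 assms by blast
  qed
qed

end

section \<open>Extension by one root\<close>

text \<open>The weights stand for the coefficients of a highest root, and \<delta> and \<epsilon>
  mark the neighbours of the new root. In a sum of nonnegative integers that is at most 1, only one
  nonzero term fits, and its weight is 1.\<close>

lemma single_mark:
  fixes \<delta> w :: "nat \<Rightarrow> int"
  assumes "(\<Sum>i<m. w i * \<delta> i) + s * \<epsilon> \<le> 1" "1 \<le> s" "\<And>i. i < m \<Longrightarrow> 1 \<le> w i"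
    and "\<epsilon> \<in> {0, 1}" "\<And>i. i < m \<Longrightarrow> \<delta> i \<in> {0, 1}" "\<epsilon> \<noteq> 0 \<or> (\<exists>i<m. \<delta> i \<noteq> 0)"
  obtains "s = 1" "\<epsilon> = 1" "\<And>i. i < m \<Longrightarrow> \<delta> i = 0"
    | j where "j < m" "w j = 1" "\<epsilon> = 0" "\<And>i. i < m \<Longrightarrow> \<delta> i = (if i = j then 1 else 0)"
proof -
  have nn: "0 \<le> w i * \<delta> i" if "i < m" for i using assms(3,5)[OF that] by auto
  then have sum_nn: "0 \<le> (\<Sum>i<m. w i * \<delta> i)" by (intro sum_nonneg) auto
  show thesis
  proof (cases "\<epsilon> = 0")
    case True
    then obtain j where j: "j < m" "\<delta> j = 1" using assms(5,6) by blast
    have "w j * \<delta> j + (\<Sum>i\<in>{..<m} - {j}. w i * \<delta> i) \<le> 1"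
      using assms(1) j(1) True by (simp add: sum.remove[of "{..<m}" j])
    moreover have rest: "0 \<le> (\<Sum>i\<in>{..<m} - {j}. w i * \<delta> i)" using nn by (intro sum_nonneg) auto
    ultimately have w: "w j = 1" and 0: "(\<Sum>i\<in>{..<m} - {j}. w i * \<delta> i) = 0"
      using assms(3)[OF j(1)] j(2) by simp_all
    have "\<delta> i = (if i = j then 1 else 0)" if "i < m" for i
    proof (cases "i = j")
      case False
      have "\<forall>i\<in>{..<m} - {j}. w i * \<delta> i = 0" using 0 nn by (subst (asm) sum_nonneg_eq_0_iff) auto
      then have "w i * \<delta> i = 0" using False that by blast
      then show ?thesis using False assms(3)[OF that] by simp
    qed (use j in simp)
    then show thesis using that(2) j w True by blast
  next
    case False
    then have \<epsilon>: "\<epsilon> = 1" using assms(4) by blast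
    then have s: "s = 1" and 0: "(\<Sum>i<m. w i * \<delta> i) = 0" using assms(1,2) sum_nn by simp_all
    have "\<forall>i\<in>{..<m}. w i * \<delta> i = 0" using 0 nn by (subst (asm) sum_nonneg_eq_0_iff) auto
    then have "\<delta> i = 0" if "i < m" for i using that assms(3)[OF that] by force
    then show thesis using that(1) s \<epsilon> by blast
  qed
qed

context pos_def_even_lattice
begin

text \<open>The vector \<open>v + \<theta>\<close> is nonzero because \<open>v\<close> lies outside
  the span, and its norm is \<open>2 * p * (2 - q)\<close>.\<close>

lemma mark_bound:
  assumes "0 < p" "form \<theta> \<theta> = 2 * p" "form v v = 2 * p" "form v \<theta> = - p * q"
    and "\<theta> \<in> zmod.span X" "v \<notin> zmod.span X"
  shows "q \<le> 1"
proof -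
  have "v + \<theta> \<noteq> 0" using assms(5,6) zmod.span_neg by (metis eq_neg_iff_add_eq_0)
  then have "0 < form (v + \<theta>) (v + \<theta>)" by (rule form_pos)
  also have "\<dots> = p * (2 * (2 - q))"
    using assms(2-4) form_sym[of \<theta> v] by (simp add: form_bilinear algebra_simps)
  finally show ?thesis using assms(1) by (simp add: zero_less_mult_iff)
qed

lemma path_single_neighbour:
  assumes "path_system p m c" "0 < p" "0 < m" "form v v = 2 * p"
    and "v \<notin> zmod.span (c ` {..<m})"
    and vals: "\<And>i. i < m \<Longrightarrow> form v (c i) \<in> {0, - p}" and nz: "\<exists>i<m. form v (c i) \<noteq> 0"
  obtains j where "j < m" "\<And>i. i < m \<Longrightarrow> form v (c i) = (if i = j then - p else 0)"
proof -
  define \<delta> where "\<delta> i = (if form v (c i) = 0 then 0 else 1 :: int)" for i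
  have \<delta>: "form v (c i) = - p * \<delta> i" if "i < m" for i using vals[OF that] by (auto simp: \<delta>_def)
  \<comment> \<open>The highest root of \<open>A_m\<close> is the sum of all simple roots.\<close>
  let ?\<theta> = "\<Sum>i<m. int_scale 1 (c i)"
  have "form ?\<theta> ?\<theta> = 2 * p"
    using path_norm[OF assms(1), of "\<lambda>_. 1"] assms(3) by (cases m) simp_all
  moreover have "form v ?\<theta> = - p * (\<Sum>i<m. 1 * \<delta> i)"
    by (simp add: form_sum_right int_scale_1 \<delta> sum_distrib_left del: mult_minus_left)
  moreover have "?\<theta> \<in> zmod.span (c ` {..<m})"
    by (intro zmod.span_sum zmod.span_scale zmod.span_base) auto
  \<comment> \<open>The summand \<open>1 * 0\<close> stands for the absent root \<open>e\<close>,
    giving the shape that \<open>single_mark\<close> expects.\<close>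
  ultimately have "(\<Sum>i<m. 1 * \<delta> i) + 1 * 0 \<le> 1"
    using mark_bound[OF assms(2) _ assms(4) _ _ assms(5)] by simp
  then show thesis
  proof (rule single_mark)
    fix j assume "j < m" "\<And>i. i < m \<Longrightarrow> \<delta> i = (if i = j then 1 else 0)"
    then show thesis using that \<delta> by simp
  qed (use nz in \<open>auto simp: \<delta>_def\<close>)
qed

text \<open>Any combination \<theta> of norm \<open>2 * p\<close> with positive coefficients can
  serve as highest root here. The assumption \<open>norm\<close> is this norm condition, evaluated
  by \<open>branch_norm\<close>.\<close>

lemma branch_single_neighbour:
  fixes w :: "nat \<Rightarrow> int" and s :: int
  assumes "branch_system p m b c e" "0 < p" "form v v = 2 * p"
    and "v \<notin> zmod.span (insert e (c ` {..<m}))"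
    and vals: "\<forall>x\<in>insert e (c ` {..<m}). form v x \<in> {0, - p}"
    and nz: "\<exists>x\<in>insert e (c ` {..<m}). form v x \<noteq> 0"
    and norm: "(\<Sum>i<m. 2 * (w i)\<^sup>2) - (\<Sum>i<m - 1. 2 * w i * w (Suc i)) + 2 * s\<^sup>2 - 2 * s * w b = 2"
    and marks: "1 \<le> s" "\<And>i. i < m \<Longrightarrow> 1 \<le> w i"
  obtains "s = 1" "form v e = - p" "\<And>i. i < m \<Longrightarrow> form v (c i) = 0"
    | j where "j < m" "w j = 1" "form v e = 0"
      "\<And>i. i < m \<Longrightarrow> form v (c i) = (if i = j then - p else 0)"
proof -
  define \<delta> where "\<delta> x = (if form v x = 0 then 0 else 1 :: int)" for x
  have \<delta>: "form v (c i) = - p * \<delta> (c i)" if "i < m" for i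
    using vals that by (auto simp: \<delta>_def)
  have \<delta>e: "form v e = - p * \<delta> e" using vals by (auto simp: \<delta>_def)
  define \<theta> where "\<theta> = (\<Sum>i<m. int_scale (w i) (c i)) + int_scale s e"
  have "form \<theta> \<theta> = 2 * p"
    unfolding branch_norm[OF assms(1) \<theta>_def] norm by simp
  moreover have "form v \<theta> = - p * ((\<Sum>i<m. w i * \<delta> (c i)) + s * \<delta> e)"
    by (simp add: \<theta>_def form_sum_right form_bilinear \<delta> \<delta>e sum_distrib_left algebra_simps sum_negf)
  moreover have "\<theta> \<in> zmod.span (insert e (c ` {..<m}))"
    unfolding \<theta>_def by (intro zmod.span_add zmod.span_sum zmod.span_scale zmod.span_base) auto
  ultimately have "(\<Sum>i<m. w i * \<delta> (c i)) + s * \<delta> e \<le> 1"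
    using mark_bound[OF assms(2) _ assms(3) _ _ assms(4)] by blast
  then show thesis
  proof (rule single_mark[OF _ marks])
    assume "s = 1" "\<delta> e = 1" "\<And>i. i < m \<Longrightarrow> \<delta> (c i) = 0"
    then show thesis using that(1) \<delta> \<delta>e by simp
  next
    fix j assume "j < m" "w j = 1" "\<delta> e = 0" "\<And>i. i < m \<Longrightarrow> \<delta> (c i) = (if i = j then 1 else 0)"
    then show thesis using that(2) \<delta> \<delta>e by simp
  qed (use nz in \<open>auto simp: \<delta>_def\<close>)
qed

section \<open>Branch diagrams prolonged at an end\<close>

lemma branch_append_ade:
  assumes "branch_system p m j c e" "0 < p" "form v v = 2 * p" "form v e = 0"
    and "\<And>i. i < m \<Longrightarrow> form v (c i) = (if i = m - 1 then - p else 0)"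
    and "zmod.independent (insert v (insert e (c ` {..<m})))"
  shows "ade_system p (insert v (insert e (c ` {..<m})))"
proof -
  \<comment> \<open>As node \<open>m\<close> of the path, \<open>v\<close> leaves the branch node at
    \<open>j\<close>, so the classification of branch diagrams applies to the longer path.\<close>
  have "insert v (insert e (c ` {..<m})) = insert e ((c(m := v)) ` {..<Suc m})"
    unfolding image_append by (rule insert_commute)
  then show ?thesis
    using branch_system_ade[OF branch_system_append[OF assms(1,3-5)] assms(2)] assms(6) by metis
qed

lemma branch_prepend_ade:
  assumes "branch_system p m j c e" "0 < p" "form v v = 2 * p" "form v e = 0"
    and "\<And>i. i < m \<Longrightarrow> form v (c i) = (if i = 0 then - p else 0)"
    and "zmod.independent (insert v (insert e (c ` {..<m})))"
  shows "ade_system p (insert v (insert e (c ` {..<m})))"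
proof -
  have "form v (c (m - Suc i)) = (if i = m - 1 then - p else 0)" if "i < m" for i
  proof -
    have "m - Suc i = 0 \<longleftrightarrow> i = m - 1" using that by linarith
    then show ?thesis using assms(5)[of "m - Suc i"] that by simp
  qed
  from branch_append_ade[OF branch_system_rev[OF assms(1)] assms(2-4) this]
  show ?thesis unfolding image_rev using assms(6) by blast
qed

text \<open>In type D, \<open>e\<close> and the last path node are both leaves at node
  \<open>m - 2\<close> and may trade places. A neighbour of \<open>e\<close> then becomes a
  neighbour of the end of the path.\<close>

lemma branch_swap:
  assumes "branch_system p m (m - 2) c e" "3 \<le> m"
  shows "branch_system p m (m - 2) (c(m - 1 := e)) (c (m - 1))"
proof -
  obtain n where m: "m = Suc n" "2 \<le> n" using assms(2) by (cases m) auto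
  note b = branch_systemD[OF assms(1)]
  have "path_system p n c" using b(1) m by (simp add: path_system_def)
  from path_system_append[OF this b(3)]
  have "path_system p m (c(n := e))" using b(5) m by auto
  moreover have "form ((c(n := e)) i) (c n) = (if i = m - 2 then - p else 0)" if "i < m" for i
  proof (cases "i = n")
    case True
    then show ?thesis using b(5)[of n] m by simp
  next
    case False
    then show ?thesis using path_systemD[OF b(1) that, of n] m that by auto
  qed
  ultimately show ?thesis
    using path_systemD[OF b(1), of n n] m by (simp add: branch_system_def)
qed

text \<open>The possible neighbours of \<open>v\<close> are the nodes with coefficient 1 in the
  highest root: all nodes for A, the three leaves for D, both path ends for \<open>E_6\<close>, one
  path end for \<open>E_7\<close>, none for \<open>E_8\<close>. Each extension is again a branch
  diagram.\<close>

lemma ade_system_insert: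
  assumes "ade_system p X" "0 < p" "zmod.independent (insert v X)" "v \<notin> X"
    and norm: "form v v = 2 * p"
    and vals: "\<forall>x\<in>X. form v x \<in> {0, - p}" and nz: "\<exists>x\<in>X. form v x \<noteq> 0"
  shows "ade_system p (insert v X)"
proof -
  have v: "v \<notin> zmod.span X"
    using zmod_independent_insertD[OF assms(3,4), of 1] by (auto simp: int_scale_1)
  consider (path) m c where "0 < m" "path_system p m c" "X = c ` {..<m}"
    | (branch) m j c e where "branch_system p m j c e" "X = insert e (c ` {..<m})"
        "3 \<le> m \<and> j = m - 2 \<or> j = 2 \<and> m \<in> {5, 6, 7}"
    using assms(1) unfolding ade_system_def by blast
  then show ?thesis
  proof cases
    case path
    have "form v (c i) \<in> {0, - p}" if "i < m" for i using vals that path(3) by blast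
    moreover have "\<exists>i<m. form v (c i) \<noteq> 0" using nz path(3) by blast
    ultimately obtain j where j: "j < m" "\<And>i. i < m \<Longrightarrow> form v (c i) = (if i = j then - p else 0)"
      using path_single_neighbour[OF path(2) assms(2) path(1) norm] v path(3) by blast
    have "form (c i) v = (if i = j then - p else 0)" if "i < m" for i
      using j(2)[OF that] form_sym[of v "c i"] by simp
    \<comment> \<open>Attached to a path, \<open>v\<close> takes the role of the extra root.\<close>
    then have "branch_system p m j c v" using path(2) norm j(1) by (simp add: branch_system_def)
    then show ?thesis
      using branch_system_ade assms(2,3) unfolding path(3) by blast
  next
    case branch
    note b = branch(1)
    note single = branch_single_neighbour[OF b assms(2) norm v[unfolded branch(2)]
        vals[unfolded branch(2)] nz[unfolded branch(2)]]
    have append: ?thesis if "form v e = 0"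
      "\<And>i. i < m \<Longrightarrow> form v (c i) = (if i = m - 1 then - p else 0)"
      using branch_append_ade[OF b assms(2) norm that] assms(3) branch(2) by simp
    have prepend: ?thesis if "form v e = 0"
      "\<And>i. i < m \<Longrightarrow> form v (c i) = (if i = 0 then - p else 0)"
      using branch_prepend_ade[OF b assms(2) norm that] assms(3) branch(2) by simp
    consider (D) "3 \<le> m" "j = m - 2" | (E6) "m = 5" "j = 2" | (E7) "m = 6" "j = 2"
      | (E8) "m = 7" "j = 2" using branch(3) by blast
    then show ?thesis
    proof cases
      case D
      \<comment> \<open>The highest root of type D has coefficient 1 at the leaves, including
        \<open>e\<close>, and 2 at the inner nodes.\<close>
      define w where "w i = (if i = 0 \<or> i = m - 1 then 1 else 2 :: int)" for i
      have "(\<Sum>i<m. 2 * (w i)\<^sup>2) - (\<Sum>i<m - 1. 2 * w i * w (Suc i)) + 2 * 1\<^sup>2 - 2 * 1 * w j = 2"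
      proof -
        \<comment> \<open>There are \<open>k + 1\<close> inner nodes. Splitting off both ends leaves
          sums with constant terms.\<close>
        define k where "k = m - 3"
        have m: "m = Suc (Suc (Suc k))" using D by (simp add: k_def)
        have w: "w 0 = 1" "w (Suc (Suc k)) = 1" "\<And>i. i < Suc k \<Longrightarrow> w (Suc i) = 2"
          by (auto simp: w_def m)
        have "(\<Sum>i<m. 2 * (w i)\<^sup>2)
            = 2 * (w 0)\<^sup>2 + (\<Sum>i<Suc k. 2 * (w (Suc i))\<^sup>2) + 2 * (w (Suc (Suc k)))\<^sup>2"
          unfolding m by (subst sum.lessThan_Suc, subst sum.lessThan_Suc_shift) (rule HOL.refl)
        also have "\<dots> = 8 * int (Suc k) + 4" by (simp add: w cong: sum.cong_simp)
        finally have 1: "(\<Sum>i<m. 2 * (w i)\<^sup>2) = 8 * int (Suc k) + 4" .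
        have "(\<Sum>i<m - 1. 2 * w i * w (Suc i)) = 2 * w 0 * w (Suc 0)
            + (\<Sum>i<k. 2 * w (Suc i) * w (Suc (Suc i))) + 2 * w (Suc k) * w (Suc (Suc k))"
          unfolding m diff_Suc_1 by (subst sum.lessThan_Suc, subst sum.lessThan_Suc_shift) (rule HOL.refl)
        also have "\<dots> = 8 * int k + 8" by (simp add: w cong: sum.cong_simp)
        finally show ?thesis using 1 w(3)[of k] D by (simp add: m)
      qed
      then show ?thesis
      proof (rule single)
        show "1 \<le> w i" for i by (simp add: w_def)
      next
        assume e: "form v e = - p" "\<And>i. i < m \<Longrightarrow> form v (c i) = 0"
        obtain n where n: "m = Suc n" using D by (cases m) auto
        \<comment> \<open>Here \<open>v\<close> is joined to \<open>e\<close>. After the swap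
          \<open>e\<close> is the last path node, and \<open>v\<close> prolongs the path.\<close>
        let ?c = "c(n := e)"
        have "branch_system p m (m - 2) ?c (c n)" using branch_swap[of p m c e] b D by (simp add: n)
        moreover have X: "X = insert (c n) (?c ` {..<m})"
          unfolding branch(2) n image_append by (simp add: lessThan_Suc insert_commute)
        ultimately show ?thesis
          using branch_append_ade[of p m "m - 2" ?c "c n" v] e assms(2,3) norm n by simp
      next
        fix i assume i: "i < m" "w i = 1" "form v e = 0"
          "\<And>k. k < m \<Longrightarrow> form v (c k) = (if k = i then - p else 0)"
        then have "i = 0 \<or> i = m - 1" by (simp add: w_def split: if_splits)
        then show ?thesis using append prepend i(3,4) by blast
      qed simp
    next
      case E6
      \<comment> \<open>The highest root of \<open>E_6\<close>, with coefficient 2 at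
        \<open>e\<close>. Prolonging the path at either end gives \<open>E_7\<close>.\<close>
      let ?w = "\<lambda>i. [1, 2, 3, 2, 1] ! i :: int"
      have marks: "i = 0 \<or> i = m - 1" if "i < m" "?w i = 1" for i
        using that unfolding E6 by (auto simp: numeral_eq_Suc less_Suc_eq)
      have "(\<Sum>i<m. 2 * (?w i)\<^sup>2) - (\<Sum>i<m - 1. 2 * ?w i * ?w (Suc i)) + 2 * 2\<^sup>2 - 2 * 2 * ?w j = 2"
        unfolding E6 by (simp add: numeral_eq_Suc)
      moreover have "1 \<le> (2 :: int)"
        by simp
      moreover have "1 \<le> ?w i" if "i < m" for i
        using that unfolding E6 by (auto simp: numeral_eq_Suc less_Suc_eq)
      ultimately show ?thesis
      proof (rule single[of ?w 2])
        fix i assume i: "i < m" "?w i = 1" "form v e = 0"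
          "\<And>k. k < m \<Longrightarrow> form v (c k) = (if k = i then - p else 0)"
        show ?thesis using marks[OF i(1,2)] append prepend i(3,4) by blast
      qed simp_all
    next
      case E7
      \<comment> \<open>The highest root of \<open>E_7\<close>, with coefficient 2 at
        \<open>e\<close>. The only coefficient 1 is at the end of the longest arm, where prolonging
        gives \<open>E_8\<close>.\<close>
      let ?w = "\<lambda>i. [2, 3, 4, 3, 2, 1] ! i :: int"
      have marks: "i = m - 1" if "i < m" "?w i = 1" for i
        using that unfolding E7 by (auto simp: numeral_eq_Suc less_Suc_eq)
      have "(\<Sum>i<m. 2 * (?w i)\<^sup>2) - (\<Sum>i<m - 1. 2 * ?w i * ?w (Suc i)) + 2 * 2\<^sup>2 - 2 * 2 * ?w j = 2"
        unfolding E7 by (simp add: numeral_eq_Suc)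
      moreover have "1 \<le> (2 :: int)"
        by simp
      moreover have "1 \<le> ?w i" if "i < m" for i
        using that unfolding E7 by (auto simp: numeral_eq_Suc less_Suc_eq)
      ultimately show ?thesis
      proof (rule single[of ?w 2])
        fix i assume i: "i < m" "?w i = 1" "form v e = 0"
          "\<And>k. k < m \<Longrightarrow> form v (c k) = (if k = i then - p else 0)"
        show ?thesis using marks[OF i(1,2)] append i(3,4) by blast
      qed simp_all
    next
      case E8
      \<comment> \<open>The highest root of \<open>E_8\<close>, with coefficient 3 at
        \<open>e\<close>. No coefficient is 1, so nothing can be attached.\<close>
      let ?w = "\<lambda>i. [2, 4, 6, 5, 4, 3, 2] ! i :: int"
      have marks: "False" if "i < m" "?w i = 1" for i
        using that unfolding E8 by (auto simp: numeral_eq_Suc less_Suc_eq)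
      have "(\<Sum>i<m. 2 * (?w i)\<^sup>2) - (\<Sum>i<m - 1. 2 * ?w i * ?w (Suc i)) + 2 * 3\<^sup>2 - 2 * 3 * ?w j = 2"
        unfolding E8 by (simp add: numeral_eq_Suc)
      moreover have "1 \<le> (3 :: int)"
        by simp
      moreover have "1 \<le> ?w i" if "i < m" for i
        using that unfolding E8 by (auto simp: numeral_eq_Suc less_Suc_eq)
      ultimately show ?thesis
      proof (rule single[of ?w 3])
        fix i assume i: "i < m" "?w i = 1" "form v e = 0"
          "\<And>k. k < m \<Longrightarrow> form v (c k) = (if k = i then - p else 0)"
        show ?thesis using marks[OF i(1,2)] by blast
      qed simp_all
    qed
  qed
qed

end

section \<open>Root components\<close>

context pos_def_even_lattice
begin

text \<open>The Gram matrix of \<open>X\<close> is invertible over the rationals, and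
  \<open>d\<close> clears the denominators. The induction is Gram-Schmidt orthogonalization.\<close>

lemma exists_prescribed_products:
  assumes "finite X" "zmod.independent X"
  shows "\<exists>r\<in>zmod.span X. \<exists>d>0. \<forall>x\<in>X. form r x = d * a x"
  using assms
proof (induction X arbitrary: a rule: finite_induct)
  case empty
  show ?case using zmod.span_zero by (intro bexI[of _ 0] exI[of _ 1]) auto
next
  case (insert b X)
  have ind: "zmod.independent X" using insert.prems by (rule zmod.independent_mono) auto
  have sub: "zmod.span X \<subseteq> zmod.span (insert b X)" by (rule zmod.span_mono) auto
  obtain u d where u: "u \<in> zmod.span X" "0 < d" "\<And>x. x \<in> X \<Longrightarrow> form u x = d * form b x"
    using insert.IH[OF ind, of "form b"] by blast
  obtain r e where r: "r \<in> zmod.span X" "0 < e" "\<And>x. x \<in> X \<Longrightarrow> form r x = e * a x"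
    using insert.IH[OF ind, of a] by blast
  \<comment> \<open>This is \<open>d\<close> times the part of \<open>b\<close> orthogonal to
    \<open>X\<close>. Its norm is \<open>d * form w b\<close>, which makes \<open>form w b\<close>
    positive.\<close>
  define w where "w = int_scale d b - u"
  have wX: "form w x = 0" if "x \<in> X" for x using u(3)[OF that] by (simp add: w_def form_bilinear)
  have "w \<noteq> 0"
  proof
    assume "w = 0"
    then have "int_scale d b \<in> zmod.span X" using u(1) by (simp add: w_def)
    then show False using zmod_independent_insertD[OF insert.prems insert.hyps(2)] u(2) by blast
  qed
  then have "0 < form w w" by (rule form_pos)
  also have "form w w = form w (int_scale d b) - form w u"
    unfolding form_diff_right[symmetric] by (simp add: w_def)
  also have "form w u = 0" using wX u(1) by (rule orthogonal_span)
  finally have wb: "0 < form w b" using u(2) by (simp add: form_scale_right zero_less_mult_iff)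
  \<comment> \<open>Multiples of \<open>w\<close> do not affect the products with \<open>X\<close>.
    Scaling \<open>r\<close> by \<open>form w b\<close> makes the correction at \<open>b\<close>
    integral.\<close>
  define r' where "r' = int_scale (form w b) r + int_scale (e * a b - form r b) w"
  have "b \<in> zmod.span (insert b X)" by (rule zmod.span_base) simp
  then have "w \<in> zmod.span (insert b X)"
    unfolding w_def using subsetD[OF sub u(1)] zmod.span_diff zmod.span_scale by blast
  then have "r' \<in> zmod.span (insert b X)"
    unfolding r'_def using subsetD[OF sub r(1)] zmod.span_add zmod.span_scale by blast
  moreover have "form r' x = form w b * e * a x" if "x \<in> insert b X" for x
  proof (cases "x = b")
    case True
    then show ?thesis by (simp add: r'_def form_bilinear algebra_simps)
  next
    case False
    then show ?thesis using that r(3) wX by (simp add: r'_def form_bilinear)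
  qed
  ultimately show ?case using wb r(2) by (intro bexI[of _ r'] exI[of _ "form w b * e"]) auto
qed

text \<open>Subtracting a root \<open>x\<close> with positive product from \<open>v\<close> stays within the coset and lowers
  \<open>form v r\<close>, where \<open>r\<close> has positive products with all of \<open>X\<close>; this terminates because
  \<open>form (v + r) (v + r)\<close> is nonnegative.\<close>

lemma antidominant_representative:
  assumes X: "finite X" "zmod.independent X" and "0 < p"
    and norm: "\<And>x. x \<in> X \<Longrightarrow> form x x = 2 * p"
    and dvd: "\<And>x y. x \<in> X \<Longrightarrow> y \<in> X \<Longrightarrow> p dvd form x y"
    and v: "form v v = 2 * p" "\<And>x. x \<in> X \<Longrightarrow> p dvd form v x" "v \<notin> zmod.span X"
  obtains v' where "v' - v \<in> zmod.span X" "form v' v' = 2 * p"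
    "\<And>x. x \<in> X \<Longrightarrow> form v' x \<in> {0, - p}"
proof -
  obtain r d where r: "0 < d" "\<And>x. x \<in> X \<Longrightarrow> form r x = d * 1"
    using exists_prescribed_products[OF X, of "\<lambda>_. 1"] by blast
  let ?P = "\<lambda>v'. v' - v \<in> zmod.span X \<and> form v' v' = 2 * p"
  have "?P v" using v zmod.span_zero by simp
  then obtain v' where v': "?P v'"
    and min: "\<And>y. ?P y \<Longrightarrow> nat (form (v' + r) (v' + r)) \<le> nat (form (y + r) (y + r))"
    using ex_has_least_nat[of ?P v "\<lambda>y. nat (form (y + r) (y + r))"] by blast
  have "form v' x \<in> {0, - p}" if x: "x \<in> X" for x
  proof -
    \<comment> \<open>Divisibility by \<open>p\<close> passes from \<open>v\<close> to its whole
      coset.\<close>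
    have "p dvd form x (v' - v)" using dvd_form_span[of X p x] dvd[OF x] v' by blast
    then have "p dvd form x (v' - v) + form v x" using v(2)[OF x] by (rule dvd_add)
    then have "p dvd form v' x" using form_sym[of x "v' - v"] by (simp add: form_diff_left)
    then obtain q where q: "form v' x = p * q" by (rule dvdE)
    have xs: "x \<in> zmod.span X" using x by (rule zmod.span_base)
    have notin: "v' \<notin> zmod.span X"
    proof
      assume "v' \<in> zmod.span X"
      then have "v' - (v' - v) \<in> zmod.span X" using v' zmod.span_diff by blast
      then show False using v(3) by simp
    qed
    \<comment> \<open>Both vectors have positive norm, which forces -2 < q < 2. Only q = 1 then has
      to be excluded.\<close>
    have "v' - x \<noteq> 0" "v' + x \<noteq> 0"
      using notin xs zmod.span_neg[OF xs] by (auto simp: add_eq_0_iff2)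
    then have "0 < form (v' - x) (v' - x)" "0 < form (v' + x) (v' + x)" by (simp_all only: form_pos not_False_eq_True)
    moreover have "form (v' - x) (v' - x) = p * (2 * (2 - q))" "form (v' + x) (v' + x) = p * (2 * (2 + q))"
      using norm[OF x] v' q form_sym[of x v'] by (simp_all add: form_bilinear algebra_simps)
    ultimately have "0 < p * (2 * (2 - q))" "0 < p * (2 * (2 + q))" by simp_all
    then have "-2 < q" "q < 2" using \<open>0 < p\<close> by (simp_all add: zero_less_mult_iff)
    moreover have "q \<noteq> 1"
    proof
      assume "q = 1"
      then have xv: "form v' x = p" "form x v' = p" using q form_sym[of x v'] by simp_all
      have "v' - x - v = (v' - v) - x" by simp
      then have "v' - x - v \<in> zmod.span X" using zmod.span_diff[OF conjunct1[OF v'] xs] by (simp only:)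
      then have "?P (v' - x)"
        using v' norm[OF x] xv by (simp add: form_bilinear)
      then have "form (v' + r) (v' + r) \<le> form (v' - x + r) (v' - x + r)"
        using min[of "v' - x"] form_self_nonneg by (simp add: nat_le_eq_zle)
      \<comment> \<open>Since \<open>v' - x\<close> has the norm of \<open>v'\<close>, only the
        product with \<open>r\<close> changes.\<close>
      moreover have "form (v' - x + r) (v' - x + r) = form (v' + r) (v' + r) - 2 * d"
        using xv norm[OF x] r(2)[OF x] form_sym[of x r] by (simp add: form_bilinear)
      ultimately show False using r(1) by simp
    qed
    ultimately have "q = 0 \<or> q = -1" by linarith
    then show ?thesis using q by auto
  qed
  then show thesis using that v' by blast
qed

section \<open>Sets whose span is a root lattice\<close>

lemma ade_system_form:
  assumes "ade_system p X"
  shows "finite X" "\<And>x. x \<in> X \<Longrightarrow> form x x = 2 * p" "\<And>x y. x \<in> X \<Longrightarrow> y \<in> X \<Longrightarrow> p dvd form x y"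
proof -
  have path: "x = y \<and> form x y = 2 * p \<or> form x y \<in> {0, - p}"
    if "path_system p m c" "x \<in> c ` {..<m}" "y \<in> c ` {..<m}" for m c x y
    using that(2,3) path_systemD[OF that(1)] by (auto split: if_splits)
  have branch: "x = y \<and> form x y = 2 * p \<or> form x y \<in> {0, - p}"
    if b: "branch_system p m j c e" "x \<in> insert e (c ` {..<m})" "y \<in> insert e (c ` {..<m})"
    for m j c e x y
    using b(2,3) path[OF branch_systemD(1)[OF b(1)], of x y] branch_systemD(3-5)[OF b(1)]
    by (auto split: if_splits)
  have norm: "form x x = 2 * p" if b: "branch_system p m j c e" "x \<in> insert e (c ` {..<m})" for m j c e x
    using b(2) path_systemD[OF branch_systemD(1)[OF b(1)]] branch_systemD(3)[OF b(1)] by auto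
  consider (path) m c where "path_system p m c" "X = c ` {..<m}"
    | (branch) m j c e where "branch_system p m j c e" "X = insert e (c ` {..<m})"
    using assms unfolding ade_system_def by blast
  then have "finite X \<and> (\<forall>x\<in>X. form x x = 2 * p) \<and> (\<forall>x\<in>X. \<forall>y\<in>X. p dvd form x y)"
  proof cases
    case a: path
    have "p dvd form x y" if "x \<in> X" "y \<in> X" for x y
      using path[OF a(1), of x y] a(2) that by auto
    moreover have "form x x = 2 * p" if "x \<in> X" for x using that a(2) path_systemD[OF a(1)] by auto
    ultimately show ?thesis using a(2) by simp
  next
    case b: branch
    have "p dvd form x y" if "x \<in> X" "y \<in> X" for x y
      using branch[OF b(1), of x y] b(2) that by auto
    moreover have "form x x = 2 * p" if "x \<in> X" for x using norm[OF b(1)] that b(2) by simp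
    ultimately show ?thesis using b(2) by simp
  qed
  then show "finite X" "\<And>x. x \<in> X \<Longrightarrow> form x x = 2 * p" "\<And>x y. x \<in> X \<Longrightarrow> y \<in> X \<Longrightarrow> p dvd form x y"
    by blast+
qed

text \<open>\<open>T\<close> keeps the given basis vectors, whose products may have either sign. The
  auxiliary simple system \<open>X\<close> with the same span carries the classification.\<close>

definition root_component :: "int \<Rightarrow> 'a set \<Rightarrow> bool" where
  "root_component p T \<longleftrightarrow> 0 < p \<and> (\<forall>\<beta>\<in>T. form \<beta> \<beta> = 2 * p) \<and>
     (\<exists>X. ade_system p X \<and> zmod.independent X \<and> zmod.span X = zmod.span T)"

lemma root_component_singleton:
  assumes "s \<noteq> 0"
  shows "root_component (form s s div 2) {s}"
proof -
  let ?p = "form s s div 2"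
  have p: "form s s = 2 * ?p" using form_even[of s] by simp
  moreover have "0 < form s s" using assms by (rule form_pos)
  moreover have "ade_system ?p {s}"
    using p by (intro ade_system_pathI[of _ 1 "\<lambda>_. s"]) (auto simp: path_system_def)
  moreover have "zmod.independent {s}"
  proof (rule zmod_independent_insertI)
    fix a assume "int_scale a s \<in> zmod.span {}"
    then have "int_scale a s = 0" by simp
    then have "a * form s s = 0" using form_scale_left[of a s s] by simp
    then show "a = 0" using assms by simp
  qed (rule zmod.independent_empty)
  ultimately show ?thesis unfolding root_component_def by (intro conjI exI[of _ "{s}"]) auto
qed

text \<open>\<open>X\<close> is extended by an antidominant representative of \<open>v\<close>,
  while \<open>T\<close> receives \<open>v\<close> itself; the two spans still agree.\<close>

lemma root_component_insert:
  assumes T: "root_component p T" and ind: "zmod.independent (insert v T)" "v \<notin> T"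
    and v: "form v v = 2 * p" "\<And>\<beta>. \<beta> \<in> T \<Longrightarrow> p dvd form v \<beta>" "\<exists>\<beta>\<in>T. form v \<beta> \<noteq> 0"
  shows "root_component p (insert v T)"
proof -
  obtain X where X: "ade_system p X" "zmod.independent X" and span: "zmod.span X = zmod.span T"
    and p: "0 < p" and norm: "\<forall>\<beta>\<in>T. form \<beta> \<beta> = 2 * p"
    using T unfolding root_component_def by blast
  note f = ade_system_form[OF X(1)]
  have free: "a = 0" if "int_scale a v \<in> zmod.span X" for a
    using zmod_independent_insertD[OF ind] that span by simp
  have "v \<notin> zmod.span X" using free[of 1] by (auto simp: int_scale_1)
  moreover have "p dvd form v x" if "x \<in> X" for x
    using dvd_form_span[of T p v x] v(2) zmod.span_base[OF that] span by simp
  ultimately obtain v' where v': "v' - v \<in> zmod.span X" "form v' v' = 2 * p"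
    "\<And>x. x \<in> X \<Longrightarrow> form v' x \<in> {0, - p}"
    using antidominant_representative[OF f(1) X(2) p f(2,3) v(1)] by blast
  have free': "a = 0" if "int_scale a v' \<in> zmod.span X" for a
  proof -
    have "int_scale a v' - int_scale a (v' - v) \<in> zmod.span X"
      by (rule zmod.span_diff[OF that zmod.span_scale[OF v'(1)]])
    then show ?thesis using free by (simp add: zmod.scale_right_diff_distrib)
  qed
  then have ind': "zmod.independent (insert v' X)" using X(2) by (rule zmod_independent_insertI[rotated])
  have "v' \<notin> X" using free'[of 1] zmod.span_base by (auto simp: int_scale_1)
  moreover have "\<exists>x\<in>X. form v' x \<noteq> 0"
  proof (rule ccontr)
    assume "\<not> ?thesis"
    then have orth: "form v' y = 0" if "y \<in> zmod.span X" for y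
      using orthogonal_span[OF _ that] by blast
    let ?k = "v' - v"
    \<comment> \<open>If \<open>v'\<close> is orthogonal to the span, the norm of \<open>v\<close>
      is that of \<open>v'\<close> plus that of \<open>?k\<close>. Equal norms give
      \<open>v' = v\<close>, which is not orthogonal to \<open>T\<close>.\<close>
    have "form v v = form v' v' - form v' ?k - form ?k v' + form ?k ?k"
      by (simp add: form_bilinear)
    then have "form ?k ?k = 0"
      using orth[OF v'(1)] form_sym[of ?k v'] v(1) v'(2) by linarith
    then have "v' = v" by simp
    obtain \<beta> where "\<beta> \<in> T" "form v \<beta> \<noteq> 0" using v(3) by blast
    then show False using orth[of \<beta>] span zmod.span_base[of \<beta> T] \<open>v' = v\<close> by simp
  qed
  ultimately have "ade_system p (insert v' X)"
    using ade_system_insert[OF X(1) p ind' _ v'(2)] v'(3) by blast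
  moreover have "zmod.span (insert v' X) = zmod.span (insert v T)"
    using zmod_span_insert_cong[OF span] v'(1) span by simp
  ultimately show ?thesis using ind' p norm v(1) unfolding root_component_def by blast
qed

section \<open>Lowering norms in a basis of screeners\<close>

lemma nonorthogonal_screeners:
  assumes "\<beta> \<in> screeners form" "\<gamma> \<in> screeners form" "form \<beta> \<gamma> \<noteq> 0" "form \<beta> \<beta> < form \<gamma> \<gamma>"
  shows "2 * \<bar>form \<beta> \<gamma>\<bar> = form \<gamma> \<gamma>"
proof -
  define \<epsilon> where "\<epsilon> = sgn (form \<beta> \<gamma>)"
  have \<epsilon>: "\<epsilon> * form \<beta> \<gamma> = \<bar>form \<beta> \<gamma>\<bar>" "\<epsilon> * \<epsilon> = 1"
    using assms(3) by (auto simp: \<epsilon>_def sgn_if)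
  obtain k where k: "2 * form \<beta> \<gamma> = form \<gamma> \<gamma> * k"
    using assms(2) unfolding screeners_iff by (meson dvdE)
  \<comment> \<open>Twice the absolute product is at most the sum of both norms, hence below
    \<open>2 * form \<gamma> \<gamma>\<close>. It is also a nonzero multiple of
    \<open>form \<gamma> \<gamma>\<close>, so the factor is 1.\<close>
  have "0 \<le> form (\<gamma> - int_scale \<epsilon> \<beta>) (\<gamma> - int_scale \<epsilon> \<beta>)" by (rule form_self_nonneg)
  also have "\<dots> = form \<gamma> \<gamma> + (\<epsilon> * \<epsilon>) * form \<beta> \<beta> - 2 * (\<epsilon> * form \<beta> \<gamma>)"
    using form_sym[of \<gamma> \<beta>] by (simp add: form_bilinear algebra_simps)
  finally have "2 * \<bar>form \<beta> \<gamma>\<bar> < 2 * form \<gamma> \<gamma>" using \<epsilon> assms(4) by simp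
  moreover have "2 * \<bar>form \<beta> \<gamma>\<bar> = form \<gamma> \<gamma> * \<bar>k\<bar>"
    using arg_cong[OF k, of abs] form_self_nonneg[of \<gamma>] by (simp add: abs_mult)
  moreover have "0 < form \<gamma> \<gamma>" using assms(4) form_self_nonneg[of \<beta>] by simp
  ultimately have "form \<gamma> \<gamma> * \<bar>k\<bar> < form \<gamma> \<gamma> * 2" "\<bar>k\<bar> \<noteq> 0" using k assms(3) by auto
  then have "\<bar>k\<bar> = 1" using \<open>0 < form \<gamma> \<gamma>\<close> by simp
  then show ?thesis using \<open>2 * \<bar>form \<beta> \<gamma>\<bar> = form \<gamma> \<gamma> * \<bar>k\<bar>\<close> by simp
qed

text \<open>An elementary basis change. The second claim ensures a genuine replacement, so that sums
  of norms can be compared.\<close>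

lemma exchange_basis:
  fixes n :: int
  assumes S: "z_basis S UNIV" "\<beta> \<in> S" "\<gamma> \<in> S" "\<beta> \<noteq> \<gamma>"
  defines "\<gamma>' \<equiv> \<gamma> - int_scale n \<beta>"
  shows "z_basis (insert \<gamma>' (S - {\<gamma>})) UNIV" "\<gamma>' \<notin> S - {\<gamma>}"
proof -
  let ?X = "S - {\<gamma>}"
  have X: "insert \<gamma> ?X = S" using S(3) by blast
  have \<beta>: "int_scale k \<beta> \<in> zmod.span ?X" for k
    using S by (intro zmod.span_scale zmod.span_base) auto
  have free: "a = 0" if "int_scale a \<gamma>' \<in> zmod.span ?X" for a
  proof -
    have "int_scale a \<gamma> = int_scale a \<gamma>' + int_scale (a * n) \<beta>"
      by (simp add: \<gamma>'_def zmod.scale_right_diff_distrib)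
    then have "int_scale a \<gamma> \<in> zmod.span ?X" using that \<beta> zmod.span_add by metis
    then show ?thesis using zmod_independent_insertD[of \<gamma> ?X a] S(1) X by (simp add: z_basis_def)
  qed
  have "zmod.independent ?X"
    using S(1) zmod.independent_mono[of S ?X] by (auto simp: z_basis_def)
  then have "zmod.independent (insert \<gamma>' ?X)" using free by (rule zmod_independent_insertI)
  moreover have "\<gamma>' - \<gamma> \<in> zmod.span ?X" using zmod.span_neg[OF \<beta>[of n]] by (simp add: \<gamma>'_def)
  then have "zmod.span (insert \<gamma>' ?X) = UNIV"
    using zmod_span_insert_cong[OF HOL.refl] S(1) X by (metis z_basis_def)
  ultimately show "z_basis (insert \<gamma>' ?X) UNIV" by (simp add: z_basis_def)
  show "\<gamma>' \<notin> ?X" using free[of 1] zmod.span_base[of \<gamma>' ?X] by (auto simp: int_scale_1)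
qed

lemma exists_homogeneous_screener_basis:
  assumes "z_basis S UNIV" "S \<subseteq> screeners form"
  obtains B where "z_basis B UNIV" "B \<subseteq> screeners form"
    "\<And>\<beta> \<gamma>. \<beta> \<in> B \<Longrightarrow> \<gamma> \<in> B \<Longrightarrow> form \<beta> \<gamma> \<noteq> 0 \<Longrightarrow> form \<beta> \<beta> = form \<gamma> \<gamma>"
proof -
  let ?P = "\<lambda>B. z_basis B UNIV \<and> B \<subseteq> screeners form"
  let ?m = "\<lambda>B. nat (\<Sum>\<beta>\<in>B. form \<beta> \<beta>)"
  obtain B where B: "?P B" and min: "\<And>B'. ?P B' \<Longrightarrow> ?m B \<le> ?m B'"
    using ex_has_least_nat[of ?P S ?m] assms by blast
  have fin: "finite B" using B z_basis_finite by blast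
  have le: "form \<gamma> \<gamma> \<le> form \<beta> \<beta>" if \<beta>: "\<beta> \<in> B" and \<gamma>: "\<gamma> \<in> B" and f: "form \<beta> \<gamma> \<noteq> 0" for \<beta> \<gamma>
  proof (rule ccontr)
    assume "\<not> ?thesis"
    then have less: "form \<beta> \<beta> < form \<gamma> \<gamma>" by simp
    have scr: "\<beta> \<in> screeners form" "\<gamma> \<in> screeners form" using B \<beta> \<gamma> by auto
    note 2 = nonorthogonal_screeners[OF scr f less]
    define \<epsilon> where "\<epsilon> = sgn (form \<beta> \<gamma>)"
    have \<epsilon>: "\<epsilon> * form \<beta> \<gamma> = \<bar>form \<beta> \<gamma>\<bar>" "\<epsilon> * \<epsilon> = 1"
      using f by (auto simp: \<epsilon>_def sgn_if)
    define \<gamma>' where "\<gamma>' = \<gamma> - int_scale \<epsilon> \<beta>"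
    have "form \<gamma>' \<gamma>' = form \<gamma> \<gamma> + (\<epsilon> * \<epsilon>) * form \<beta> \<beta> - 2 * (\<epsilon> * form \<beta> \<gamma>)"
      using form_sym[of \<gamma> \<beta>] by (simp add: \<gamma>'_def form_bilinear algebra_simps)
    \<comment> \<open>Twice the absolute product cancels the norm of \<gamma>.\<close>
    then have norm: "form \<gamma>' \<gamma>' = form \<beta> \<beta>" using \<epsilon> 2 by simp
    let ?B = "insert \<gamma>' (B - {\<gamma>})"
    have ex: "z_basis ?B UNIV" "\<gamma>' \<notin> B - {\<gamma>}"
      using exchange_basis[of B \<beta> \<gamma> \<epsilon>] B \<beta> \<gamma> less by (auto simp: \<gamma>'_def)
    \<comment> \<open>The norm of \<beta> divides twice its product with \<gamma>, which is the norm
      of \<gamma> up to sign. Hence it divides both terms of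
      \<open>2 * form \<alpha> \<gamma>'\<close>.\<close>
    have "form \<beta> \<beta> dvd form \<gamma> \<gamma>"
    proof -
      have "form \<beta> \<beta> dvd 2 * form \<gamma> \<beta>" using scr(1) by (simp add: screeners_iff)
      then have "form \<beta> \<beta> dvd \<bar>2 * form \<gamma> \<beta>\<bar>" by simp
      then show ?thesis using 2 form_sym[of \<gamma> \<beta>] by (simp add: abs_mult)
    qed
    then have "form \<gamma>' \<gamma>' dvd 2 * form \<alpha> \<gamma>'" for \<alpha>
    proof -
      have "form \<beta> \<beta> dvd 2 * form \<alpha> \<gamma>"
        using \<open>form \<beta> \<beta> dvd form \<gamma> \<gamma>\<close> scr(2) by (meson dvd_trans screeners_iff)
      moreover have "form \<beta> \<beta> dvd \<epsilon> * (2 * form \<alpha> \<beta>)" using scr(1) by (simp add: screeners_iff)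
      ultimately have "form \<beta> \<beta> dvd 2 * form \<alpha> \<gamma> - \<epsilon> * (2 * form \<alpha> \<beta>)" by (rule dvd_diff)
      then show ?thesis unfolding norm by (simp add: \<gamma>'_def form_bilinear algebra_simps)
    qed
    then have "\<gamma>' \<in> screeners form" using basis_not_even[OF ex(1)] by (simp add: screeners_iff)
    then have "?P ?B" using ex(1) B by auto
    then have "?m B \<le> ?m ?B" by (rule min)
    moreover have "0 \<le> (\<Sum>\<beta>\<in>?B. form \<beta> \<beta>)" by (intro sum_nonneg form_self_nonneg)
    ultimately have "(\<Sum>\<beta>\<in>B. form \<beta> \<beta>) \<le> (\<Sum>\<beta>\<in>?B. form \<beta> \<beta>)" by linarith
    also have "\<dots> = form \<beta> \<beta> + (\<Sum>\<beta>\<in>B - {\<gamma>}. form \<beta> \<beta>)" using ex(2) fin norm by simp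
    also have "\<dots> < form \<gamma> \<gamma> + (\<Sum>\<beta>\<in>B - {\<gamma>}. form \<beta> \<beta>)" using less by simp
    also have "\<dots> = (\<Sum>\<beta>\<in>B. form \<beta> \<beta>)" using \<gamma> fin by (simp add: sum.remove)
    finally show False by simp
  qed
  have "form \<beta> \<beta> = form \<gamma> \<gamma>" if "\<beta> \<in> B" "\<gamma> \<in> B" "form \<beta> \<gamma> \<noteq> 0" for \<beta> \<gamma>
    using le[OF that] le[OF that(2,1)] that(3) form_sym[of \<beta> \<gamma>] by simp
  then show thesis using that B by blast
qed

section \<open>Orthogonal components of a screener basis\<close>

definition orthogonal_components :: "'a set \<Rightarrow> nat \<Rightarrow> (nat \<Rightarrow> 'a set) \<Rightarrow> (nat \<Rightarrow> int) \<Rightarrow> bool" where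
  "orthogonal_components S k C p \<longleftrightarrow> S = (\<Union>i<k. C i) \<and> disjoint_family_on C {..<k} \<and>
     (\<forall>i<k. root_component (p i) (C i)) \<and>
     (\<forall>i<k. \<forall>j<k. i \<noteq> j \<longrightarrow> (\<forall>x\<in>C i. \<forall>y\<in>C j. form x y = 0))"

text \<open>A maximal root component through \<open>s\<close> is orthogonal to all other elements,
  since a non-orthogonal one could be absorbed. Induction handles the remaining elements.\<close>

lemma exists_orthogonal_components:
  assumes "finite S" "zmod.independent S" "S \<subseteq> screeners form"
    and "\<And>\<beta> \<gamma>. \<beta> \<in> S \<Longrightarrow> \<gamma> \<in> S \<Longrightarrow> form \<beta> \<gamma> \<noteq> 0 \<Longrightarrow> form \<beta> \<beta> = form \<gamma> \<gamma>"
  shows "\<exists>k C p. orthogonal_components S k C p"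
  using assms
proof (induction S rule: finite_psubset_induct)
  case (psubset S)
  show ?case
  proof (cases "S = {}")
    case True
    then show ?thesis by (intro exI[of _ 0]) (simp add: orthogonal_components_def disjoint_family_on_def)
  next
    case False
    then obtain s where s: "s \<in> S" by blast
    then have "s \<noteq> 0" using psubset.prems(2) zmod.dependent_zero psubset.prems(1) by blast
    define F where "F = {T. T \<subseteq> S \<and> (\<exists>p. root_component p T)}"
    have "{s} \<in> F" using root_component_singleton[OF \<open>s \<noteq> 0\<close>] s by (auto simp: F_def)
    moreover have "finite F" using psubset.hyps by (simp add: F_def)
    ultimately obtain T where "T \<in> F" "{s} \<subseteq> T" and max: "\<And>T'. T' \<in> F \<Longrightarrow> T \<subseteq> T' \<Longrightarrow> T = T'"
      using finite_has_maximal2[of F "{s}"] by metis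
    then obtain q where T: "T \<subseteq> S" "s \<in> T" and q: "root_component q T" by (auto simp: F_def)
    have orth: "form v \<beta> = 0" if v: "v \<in> S - T" and \<beta>: "\<beta> \<in> T" for v \<beta>
    proof (rule ccontr)
      assume f: "form v \<beta> \<noteq> 0"
      have norm: "form \<gamma> \<gamma> = 2 * q" if "\<gamma> \<in> T" for \<gamma>
        using q that by (simp add: root_component_def)
      have vS: "v \<in> S" "\<beta> \<in> S" using v \<beta> T(1) by auto
      have vv: "form v v = 2 * q" using psubset.prems(3)[OF vS f] norm[OF \<beta>] by simp
      have "q dvd form v \<gamma>" if "\<gamma> \<in> T" for \<gamma>
      proof -
        have "\<gamma> \<in> screeners form" using that T(1) psubset.prems(2) by blast
        \<comment> \<open>The screener condition for \<gamma>, whose norm is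
          \<open>2 * q\<close>.\<close>
        then have "2 * q dvd 2 * form v \<gamma>" using norm[OF that] unfolding screeners_iff by metis
        then show ?thesis by simp
      qed
      moreover have "zmod.independent (insert v T)"
        using vS T(1) by (intro zmod.independent_mono[OF psubset.prems(1)]) auto
      ultimately have "root_component q (insert v T)"
        using root_component_insert[OF q _ _ vv] v \<beta> f by blast
      then have "insert v T \<in> F" using vS T(1) by (auto simp: F_def)
      then show False using max[of "insert v T"] v by blast
    qed
    have "S - T \<subset> S" using T(2) s by blast
    moreover have "zmod.independent (S - T)"
      by (rule zmod.independent_mono[OF psubset.prems(1)]) auto
    moreover have "S - T \<subseteq> screeners form" using psubset.prems(2) by blast
    ultimately obtain k C p where *: "orthogonal_components (S - T) k C p"
      using psubset.IH psubset.prems(3) by (metis DiffD1)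
    then have U: "S - T = (\<Union>i<k. C i)" and dj: "disjoint_family_on C {..<k}"
      and rc: "\<And>i. i < k \<Longrightarrow> root_component (p i) (C i)"
      unfolding orthogonal_components_def by simp_all
    have oC: "form x y = 0" if "i < k" "j < k" "i \<noteq> j" "x \<in> C i" "y \<in> C j" for i j x y
      using * that unfolding orthogonal_components_def by simp
    define C' where "C' = C(k := T)"
    have C': "C' k = T" "\<And>i. i < k \<Longrightarrow> C' i = C i" by (auto simp: C'_def)
    have sub: "C i \<subseteq> S - T" if "i < k" for i using U that by blast
    have "S = (\<Union>i<Suc k. C' i)"
    proof -
      have "(\<Union>i<Suc k. C' i) = T \<union> (\<Union>i<k. C i)" using C' by (simp add: lessThan_Suc)
      then show ?thesis unfolding U[symmetric] using T(1) by blast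
    qed
    moreover have "disjoint_family_on C' {..<Suc k}"
      unfolding disjoint_family_on_def
    proof (intro ballI impI)
      fix i j assume "i \<in> {..<Suc k}" "j \<in> {..<Suc k}" "i \<noteq> j"
      then consider "i = k" "j < k" | "j = k" "i < k" | "i < k" "j < k" "i \<noteq> j"
        by (metis lessThan_iff less_Suc_eq)
      then show "C' i \<inter> C' j = {}"
      proof cases
        case 1
        then show ?thesis using C' sub[of j] by auto
      next
        case 2
        then show ?thesis using C' sub[of i] by auto
      next
        case 3
        then show ?thesis using C' dj by (simp add: disjoint_family_on_def)
      qed
    qed
    moreover have "\<forall>i<Suc k. root_component ((p(k := q)) i) (C' i)"
      using q rc C' by (simp add: less_Suc_eq)
    moreover have "form x y = 0"
      if ij: "i < Suc k" "j < Suc k" "i \<noteq> j" and "x \<in> C' i" "y \<in> C' j" for i j x y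
    proof -
      consider "i = k" "j < k" | "j = k" "i < k" | "i < k" "j < k"
        using ij by (metis less_Suc_eq)
      then show ?thesis
      proof cases
        case 1
        then show ?thesis using orth[of y x] that C' sub[of j] form_sym[of x y] by auto
      next
        case 2
        then show ?thesis using orth[of x y] that C' sub[of i] by auto
      next
        case 3
        then show ?thesis using oC that C' by simp
      qed
    qed
    ultimately have "orthogonal_components S (Suc k) C' (p(k := q))"
      unfolding orthogonal_components_def by blast
    then show ?thesis by blast
  qed
qed

end

section \<open>Isometries with root lattices\<close>

lemma z_span_union_decompose:
  assumes "x \<in> zmod.span (\<Union>i<k::nat. C i)"
  shows "\<exists>f. (\<forall>i<k. f i \<in> zmod.span (C i)) \<and> x = (\<Sum>i<k. f i)"
  using assms
proof (induction k arbitrary: x)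
  case 0
  then show ?case by simp
next
  case (Suc k)
  have "(\<Union>i<Suc k. C i) = C k \<union> (\<Union>i<k. C i)" by (simp add: lessThan_Suc)
  then have "x \<in> zmod.span (C k \<union> (\<Union>i<k. C i))" using Suc.prems by simp
  then obtain y z where yz: "y \<in> zmod.span (C k)" "z \<in> zmod.span (\<Union>i<k. C i)" "x = y + z"
    unfolding zmod.span_Un by blast
  obtain f where f: "\<forall>i<k. f i \<in> zmod.span (C i)" "z = (\<Sum>i<k. f i)" using Suc.IH yz(2) by blast
  have "(\<Sum>i<k. (f(k := y)) i) = (\<Sum>i<k. f i)" by (intro sum.cong) auto
  then have "x = (\<Sum>i<Suc k. (f(k := y)) i)" using yz(3) f(2) by (simp add: add.commute)
  moreover have "\<forall>i<Suc k. (f(k := y)) i \<in> zmod.span (C i)" using f(1) yz(1) by (simp add: less_Suc_eq)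
  ultimately show ?case by blast
qed

lemma cartan_matrix_D:
  "cartan_matrix (Dyn_D n) i k = (if i = k then 2
     else if k = Suc i \<and> Suc k < n \<or> i = Suc k \<and> Suc i < n \<or>
       k = i + 2 \<and> Suc k = n \<or> i = k + 2 \<and> Suc i = n then - 1 else 0)"
proof -
  have edge: "(a, c) \<in> dynkin_edges (Dyn_D n) \<longleftrightarrow> c = Suc a \<and> Suc c < n \<or> c = a + 2 \<and> Suc c = n" for a c
    by auto
  show ?thesis unfolding cartan_matrix_def edge by (intro if_cong HOL.refl) blast
qed

lemma cartan_matrix_E:
  "cartan_matrix (Dyn_E n) i k = (if i = k then 2
     else if k = Suc i \<and> Suc k < n \<or> i = Suc k \<and> Suc i < n \<or>
       i = 2 \<and> k = n - 1 \<or> k = 2 \<and> i = n - 1 then - 1 else 0)"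
proof -
  have edge: "(a, c) \<in> dynkin_edges (Dyn_E n) \<longleftrightarrow> c = Suc a \<and> Suc c < n \<or> a = 2 \<and> c = n - 1" for a c
    by auto
  show ?thesis unfolding cartan_matrix_def edge by (intro if_cong HOL.refl) blast
qed

section \<open>Orthogonal direct sums of spans\<close>

context pos_def_even_lattice
begin

lemma orthogonal_spans:
  assumes "\<forall>x\<in>X. \<forall>y\<in>Y. form x y = 0" "x \<in> zmod.span X" "y \<in> zmod.span Y"
  shows "form x y = 0"
proof (rule orthogonal_span[OF _ assms(3)])
  fix y assume y: "y \<in> Y"
  have "form y x = 0"
    by (rule orthogonal_span[OF _ assms(2)]) (use assms(1) y form_sym[of y] in auto)
  then show "form x y = 0" by (simp add: form_sym[of x])
qed

lemma orthogonal_direct_sum_spans: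
  assumes span: "zmod.span (\<Union>i<k::nat. C i) = UNIV"
    and orth: "\<forall>i<k. \<forall>j<k. i \<noteq> j \<longrightarrow> (\<forall>x\<in>C i. \<forall>y\<in>C j. form x y = 0)"
  shows "orthogonal_direct_sum form {..<k} (\<lambda>i. zmod.span (C i))"
proof -
  have orth': "form x y = 0"
    if "i < k" "j < k" "i \<noteq> j" "x \<in> zmod.span (C i)" "y \<in> zmod.span (C j)" for i j x y
    using orthogonal_spans[OF _ that(4,5)] orth that(1-3) by blast
  have ex: "\<exists>f. f \<in> (\<Pi>\<^sub>E i\<in>{..<k}. zmod.span (C i)) \<and> x = (\<Sum>i<k. f i)" for x
  proof -
    obtain f where f: "\<forall>i<k. f i \<in> zmod.span (C i)" "x = (\<Sum>i<k. f i)"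
      using z_span_union_decompose[where k = k and C = C and x = x] span by auto
    \<comment> \<open>Functions in \<open>Pi\<^sub>E\<close> must be \<open>undefined\<close>
      outside the index set.\<close>
    have "restrict f {..<k} \<in> (\<Pi>\<^sub>E i\<in>{..<k}. zmod.span (C i))" using f(1) by simp
    moreover have "x = (\<Sum>i<k. restrict f {..<k} i)" using f(2) by simp
    ultimately show ?thesis by blast
  qed
  have uniq: "f = g" if f: "f \<in> (\<Pi>\<^sub>E i\<in>{..<k}. zmod.span (C i))" and g: "g \<in> (\<Pi>\<^sub>E i\<in>{..<k}. zmod.span (C i))"
    and eq: "(\<Sum>i<k. f i) = (\<Sum>i<k. g i)" for f g
  proof (rule PiE_ext[OF f g])
    fix j assume j: "j \<in> {..<k}"
    have d: "f i - g i \<in> zmod.span (C i)" if "i < k" for i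
      using f g that by (intro zmod.span_diff) (auto simp: PiE_iff)
    \<comment> \<open>Pairing the vanishing total difference with its component at \<open>j\<close>
      removes all other components, so this component has norm 0.\<close>
    have "0 = form (f j - g j) (\<Sum>i<k. f i - g i)" using eq by (simp add: sum_subtractf)
    also have "\<dots> = (\<Sum>i<k. if i = j then form (f j - g j) (f j - g j) else 0)"
      unfolding form_sum_right using orth'[OF _ _ _ d d] j by (intro sum.cong) auto
    also have "\<dots> = form (f j - g j) (f j - g j)" using j by simp
    finally show "f j = g j" using form_self_eq_0_iff[of "f j - g j"] by simp
  qed
  show ?thesis
    unfolding orthogonal_direct_sum_def using orth' ex uniq by (auto simp: zmod.subspace_span)
qed

section \<open>Simple systems as bases of standard root lattices\<close>

lemma ade_system_dynkin:
  assumes "ade_system p X"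
  obtains t b where "t \<in> ade_types" "X = b ` {..<dynkin_rank t}"
    "\<And>i k. i < dynkin_rank t \<Longrightarrow> k < dynkin_rank t \<Longrightarrow> form (b i) (b k) = p * cartan_matrix t i k"
proof -
  consider (path) m c where "0 < m" "path_system p m c" "X = c ` {..<m}"
    | (D) m c e where "branch_system p m (m - 2) c e" "X = insert e (c ` {..<m})" "3 \<le> m"
    | (E) m c e where "branch_system p m 2 c e" "X = insert e (c ` {..<m})" "m \<in> {5, 6, 7}"
    using assms unfolding ade_system_def by blast
  then show thesis
  proof cases
    case path
    show thesis
    proof (rule that[of "Dyn_A m" c])
      show "form (c i) (c k) = p * cartan_matrix (Dyn_A m) i k"
        if "i < dynkin_rank (Dyn_A m)" "k < dynkin_rank (Dyn_A m)" for i k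
        using path_systemD[OF path(2), of i k] that by (auto simp: cartan_matrix_def)
    qed (use path in \<open>auto simp: ade_types_def\<close>)
  next
    case D
    note b = branch_systemD[OF D(1)]
    show thesis
    \<comment> \<open>For rank \<open>n = m + 1\<close> the root \<open>e\<close> gets the last
      index \<open>n - 1\<close>, and its neighbour \<open>m - 2\<close> is node
      \<open>n - 3\<close> of the standard diagram.\<close>
    proof (rule that[of "Dyn_D (Suc m)" "c(m := e)"])
      fix i k assume "i < dynkin_rank (Dyn_D (Suc m))" "k < dynkin_rank (Dyn_D (Suc m))"
      then consider "i < m" "k < m" | "i = m" "k < m" | "i < m" "k = m" | "i = m" "k = m"
        by (auto simp: less_Suc_eq)
      then show "form ((c(m := e)) i) ((c(m := e)) k) = p * cartan_matrix (Dyn_D (Suc m)) i k"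
      proof cases
        case 1
        then show ?thesis using path_systemD[OF b(1), of i k] by (auto simp: cartan_matrix_D)
      next
        case 2
        then have "cartan_matrix (Dyn_D (Suc m)) i k = (if k = m - 2 then - 1 else 0)"
          using D(3) by (auto simp: cartan_matrix_D)
        then show ?thesis using b(5)[of k] 2 by simp
      next
        case 3
        then have "cartan_matrix (Dyn_D (Suc m)) i k = (if i = m - 2 then - 1 else 0)"
          using D(3) by (auto simp: cartan_matrix_D)
        then show ?thesis using b(4)[of i] 3 by simp
      next
        case 4
        then show ?thesis using b(3) by (simp add: cartan_matrix_D)
      qed
    next
      show "X = (c(m := e)) ` {..<dynkin_rank (Dyn_D (Suc m))}"
        unfolding dynkin_rank.simps image_append D(2) ..
    qed (auto simp: ade_types_def)
  next
    case E
    note b = branch_systemD[OF E(1)]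
    show thesis
    \<comment> \<open>Again \<open>e\<close> gets the last index, joined to node 2; the values of
      \<open>m\<close> give ranks 6, 7 and 8.\<close>
    proof (rule that[of "Dyn_E (Suc m)" "c(m := e)"])
      show "Dyn_E (Suc m) \<in> ade_types" using E(3) by (auto simp: ade_types_def)
      fix i k assume "i < dynkin_rank (Dyn_E (Suc m))" "k < dynkin_rank (Dyn_E (Suc m))"
      then consider "i < m" "k < m" | "i = m" "k < m" | "i < m" "k = m" | "i = m" "k = m"
        by (auto simp: less_Suc_eq)
      then show "form ((c(m := e)) i) ((c(m := e)) k) = p * cartan_matrix (Dyn_E (Suc m)) i k"
      proof cases
        case 1
        then show ?thesis using path_systemD[OF b(1), of i k] by (auto simp: cartan_matrix_E)
      next
        case 2
        then have "cartan_matrix (Dyn_E (Suc m)) i k = (if k = 2 then - 1 else 0)"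
          using E(3) by (auto simp: cartan_matrix_E)
        then show ?thesis using b(5)[of k] 2 by simp
      next
        case 3
        then have "cartan_matrix (Dyn_E (Suc m)) i k = (if i = 2 then - 1 else 0)"
          using E(3) by (auto simp: cartan_matrix_E)
        then show ?thesis using b(4)[of i] 3 by simp
      next
        case 4
        then show ?thesis using b(3) by (simp add: cartan_matrix_E)
      qed
    next
      show "X = (c(m := e)) ` {..<dynkin_rank (Dyn_E (Suc m))}"
        unfolding dynkin_rank.simps image_append E(2) ..
    qed
  qed
qed

text \<open>The map \<psi> sends coordinates to vectors, where additivity and the Gram matrix are
  direct computations; the isometry is its inverse.\<close>

lemma lattice_isometric_root_lattice:
  assumes ind: "zmod.independent (b ` {..<dynkin_rank t})"
    and inj: "inj_on b {..<dynkin_rank t}"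
    and gram: "\<And>i k. i < dynkin_rank t \<Longrightarrow> k < dynkin_rank t \<Longrightarrow> form (b i) (b k) = q * cartan_matrix t i k"
  shows "lattice_isometric (zmod.span (b ` {..<dynkin_rank t})) form
    (root_lattice t) (\<lambda>x y. q * root_form t x y)"
proof -
  let ?n = "dynkin_rank t"
  let ?M = "zmod.span (b ` {..<?n})"
  define \<psi> where "\<psi> x = (\<Sum>i<?n. int_scale (Poly_Mapping.lookup x i) (b i))" for x
  have add: "\<psi> (x + y) = \<psi> x + \<psi> y" for x y
    by (simp add: \<psi>_def lookup_add int_scale_add_left sum.distrib)
  have iso: "form (\<psi> x) (\<psi> y) = q * root_form t x y" for x y
    unfolding \<psi>_def root_form_def form_sum_left
    unfolding form_sum_right form_scale_left form_scale_right sum_distrib_left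
    by (intro sum.cong HOL.refl) (simp add: gram algebra_simps)
  have inj\<psi>: "inj_on \<psi> (root_lattice t)"
  proof (rule inj_onI)
    fix x y assume xy: "x \<in> root_lattice t" "y \<in> root_lattice t" "\<psi> x = \<psi> y"
    define u where "u i = Poly_Mapping.lookup x i - Poly_Mapping.lookup y i" for i
    let ?u = "\<lambda>w. u (inv_into {..<?n} b w)"
    have "(\<Sum>w\<in>b ` {..<?n}. int_scale (?u w) w) = (\<Sum>i<?n. int_scale (u i) (b i))"
      by (simp add: sum.reindex[OF inj] inv_into_f_f[OF inj])
    also have "\<dots> = 0"
      using xy(3) by (simp add: \<psi>_def u_def zmod.scale_left_diff_distrib sum_subtractf)
    finally have "?u (b i) = 0" if "i < ?n" for i
      using zmod.independentD[OF ind, of "b ` {..<?n}" ?u "b i"] that by simp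
    then have "Poly_Mapping.lookup x i = Poly_Mapping.lookup y i" if "i < ?n" for i
      using that inv_into_f_f[OF inj] by (simp add: u_def)
    moreover have "Poly_Mapping.lookup x i = Poly_Mapping.lookup y i" if "\<not> i < ?n" for i
    proof -
      have "i \<notin> Poly_Mapping.keys x" "i \<notin> Poly_Mapping.keys y"
        using xy(1,2) that by (auto simp: root_lattice_def)
      then show ?thesis by (simp add: in_keys_iff)
    qed
    ultimately show "x = y" by (intro poly_mapping_eqI) blast
  qed
  have "\<psi> ` root_lattice t = ?M"
  proof (rule subset_antisym)
    show "\<psi> ` root_lattice t \<subseteq> ?M"
      unfolding \<psi>_def by (intro image_subsetI zmod.span_sum zmod.span_scale[OF zmod.span_base]) auto
    show "?M \<subseteq> \<psi> ` root_lattice t"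
    proof
      fix x assume "x \<in> ?M"
      then obtain u where "x = (\<Sum>w\<in>b ` {..<?n}. int_scale (u w) w)"
        using zmod.span_finite[of "b ` {..<?n}"] by auto
      then have x: "x = (\<Sum>i<?n. int_scale (u (b i)) (b i))" by (simp add: sum.reindex[OF inj])
      \<comment> \<open>The coordinates of \<open>x\<close>, set to 0 beyond the rank so that the
        keys stay in range.\<close>
      define y where "y = Abs_poly_mapping (\<lambda>i. if i < ?n then u (b i) else 0)"
      have "finite {i. (if i < ?n then u (b i) else 0) \<noteq> 0}"
        by (rule finite_subset[of _ "{..<?n}"]) auto
      then have y: "Poly_Mapping.lookup y i = (if i < ?n then u (b i) else 0)" for i
        by (simp add: y_def)
      have "Poly_Mapping.keys y \<subseteq> {..<?n}"
        by (auto simp: in_keys_iff y split: if_splits)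
      then have "y \<in> root_lattice t" by (simp add: root_lattice_def)
      moreover have "\<psi> y = x" using x by (simp add: \<psi>_def y)
      ultimately show "x \<in> \<psi> ` root_lattice t" by blast
    qed
  qed
  then have bij: "bij_betw \<psi> (root_lattice t) ?M" using inj\<psi> by (simp add: bij_betw_def)
  let ?\<phi> = "inv_into (root_lattice t) \<psi>"
  have \<phi>: "?\<phi> x \<in> root_lattice t" "\<psi> (?\<phi> x) = x" if "x \<in> ?M" for x
    using bij that by (auto simp: bij_betw_def inv_into_into f_inv_into_f)
  have closed: "x + y \<in> root_lattice t" if "x \<in> root_lattice t" "y \<in> root_lattice t" for x y
    using that keys_add[of x y] by (auto simp: root_lattice_def)
  show ?thesis
    unfolding lattice_isometric_def
  proof (intro exI[of _ ?\<phi>] conjI ballI)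
    show "bij_betw ?\<phi> ?M (root_lattice t)" using bij by (rule bij_betw_inv_into)
    fix x y assume xy: "x \<in> ?M" "y \<in> ?M"
    show "?\<phi> (x + y) = ?\<phi> x + ?\<phi> y"
    proof (rule inj_onD[OF inj\<psi>])
      show "\<psi> (?\<phi> (x + y)) = \<psi> (?\<phi> x + ?\<phi> y)"
        using \<phi> xy zmod.span_add[OF xy] by (simp add: add)
    qed (use \<phi> xy zmod.span_add[OF xy] closed in auto)
    show "q * root_form t (?\<phi> x) (?\<phi> y) = form x y"
      using \<phi> xy by (simp add: iso[symmetric])
  qed
qed

lemma root_component_isometric:
  assumes "root_component p T"
  shows "\<exists>t\<in>ade_types. lattice_isometric (zmod.span T) form
    (root_lattice t) (\<lambda>x y. p * root_form t x y)"
proof -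
  obtain X where X: "ade_system p X" "zmod.independent X" "zmod.span X = zmod.span T" and "0 < p"
    using assms unfolding root_component_def by blast
  obtain t b where t: "t \<in> ade_types" "X = b ` {..<dynkin_rank t}"
    and gram: "\<And>i k. i < dynkin_rank t \<Longrightarrow> k < dynkin_rank t \<Longrightarrow>
      form (b i) (b k) = p * cartan_matrix t i k"
    using ade_system_dynkin[OF X(1)] by blast
  \<comment> \<open>Equal values at distinct nodes would give \<open>2 * p = 0\<close> or
    \<open>2 * p = - p\<close>.\<close>
  have "inj_on b {..<dynkin_rank t}"
  proof (rule inj_onI, rule ccontr)
    fix i k assume ik: "i \<in> {..<dynkin_rank t}" "k \<in> {..<dynkin_rank t}" "b i = b k" "i \<noteq> k"
    then have "p * cartan_matrix t i i = p * cartan_matrix t i k"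
      using gram[of i i] gram[of i k] by simp
    then show False using ik(4) \<open>0 < p\<close> by (simp add: cartan_matrix_def split: if_splits)
  qed
  then show ?thesis
    using lattice_isometric_root_lattice[of b t p] X t gram by auto
qed

end

section \<open>The orthogonal decomposition of the lattice\<close>

theorem theorem5p11:
  fixes form :: "'a::ab_group_add \<Rightarrow> 'a \<Rightarrow> int"
  assumes "pos_def_even_lattice form"
    and "\<exists>S. screening_system form S \<and> zmod.span S = UNIV"
  shows "\<exists>B. z_basis B UNIV \<and> B \<subseteq> screeners form \<and>
    (\<exists>(k::nat) (M :: nat \<Rightarrow> 'a set) (C :: nat \<Rightarrow> 'a set) (p :: nat \<Rightarrow> nat) (t :: nat \<Rightarrow> dynkin_type).
      orthogonal_direct_sum form {..<k} M \<and>
      B = (\<Union>i<k. C i) \<and> disjoint_family_on C {..<k} \<and>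
      (\<forall>i<k. z_basis (C i) (M i) \<and> p i > 0 \<and> t i \<in> ade_types \<and>
        lattice_isometric (M i) form
          (root_lattice (t i)) (\<lambda>x y. int (p i) * root_form (t i) x y)))"
proof -
  interpret pos_def_even_lattice form by fact
  obtain S where S: "screening_system form S" "zmod.span S = UNIV" using assms(2) by blast
  \<comment> \<open>Complex independence implies integral independence, so the generating system is
    a basis from which the norm reduction can start.\<close>
  then have "z_basis S UNIV" "S \<subseteq> screeners form"
    using screening_system_independent by (auto simp: z_basis_def screening_system_def)
  then obtain B where B: "z_basis B UNIV" "B \<subseteq> screeners form"
    and hom: "\<And>\<beta> \<gamma>. \<beta> \<in> B \<Longrightarrow> \<gamma> \<in> B \<Longrightarrow> form \<beta> \<gamma> \<noteq> 0 \<Longrightarrow> form \<beta> \<beta> = form \<gamma> \<gamma>"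
    using exists_homogeneous_screener_basis by blast
  have ind: "zmod.independent B" and span: "zmod.span B = UNIV" using B(1) by (auto simp: z_basis_def)
  obtain k C p where "orthogonal_components B k C p"
    using exists_orthogonal_components[OF z_basis_finite[OF B(1)] ind B(2) hom] by blast
  then have C: "B = (\<Union>i<k. C i)" "disjoint_family_on C {..<k}"
    and rc: "\<forall>i<k. root_component (p i) (C i)"
    and orth: "\<forall>i<k. \<forall>j<k. i \<noteq> j \<longrightarrow> (\<forall>x\<in>C i. \<forall>y\<in>C j. form x y = 0)"
    unfolding orthogonal_components_def by blast+
  have "\<forall>i\<in>{..<k}. \<exists>t. t \<in> ade_types \<and> lattice_isometric (zmod.span (C i)) form
      (root_lattice t) (\<lambda>x y. p i * root_form t x y)"
  proof
    fix i assume "i \<in> {..<k}"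
    then have "root_component (p i) (C i)" using rc by simp
    from root_component_isometric[OF this]
    show "\<exists>t. t \<in> ade_types \<and> lattice_isometric (zmod.span (C i)) form
        (root_lattice t) (\<lambda>x y. p i * root_form t x y)"
      by (simp only: Bex_def)
  qed
  from bchoice[OF this] obtain t where t: "\<forall>i\<in>{..<k}. t i \<in> ade_types \<and>
      lattice_isometric (zmod.span (C i)) form (root_lattice (t i)) (\<lambda>x y. p i * root_form (t i) x y)" ..
  have sum: "orthogonal_direct_sum form {..<k} (\<lambda>i. zmod.span (C i))"
    using orthogonal_direct_sum_spans orth span C(1) by blast
  \<comment> \<open>The scale \<open>p i\<close> is a positive integer, so passing through
    \<open>nat\<close> preserves it.\<close>
  have "z_basis (C i) (zmod.span (C i)) \<and> nat (p i) > 0 \<and> t i \<in> ade_types \<and>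
      lattice_isometric (zmod.span (C i)) form
        (root_lattice (t i)) (\<lambda>x y. int (nat (p i)) * root_form (t i) x y)" if "i < k" for i
  proof -
    have "zmod.independent (C i)" using C(1) that by (intro zmod.independent_mono[OF ind]) auto
    moreover have "0 < p i" using rc that by (auto simp: root_component_def)
    ultimately show ?thesis using t that by (simp add: z_basis_def)
  qed
  then show ?thesis using B C sum
    by (intro exI[of _ B] conjI exI[of _ k] exI[of _ "\<lambda>i. zmod.span (C i)"] exI[of _ C]
        exI[of _ "\<lambda>i. nat (p i)"] exI[of _ t]) simp_all
qed

end
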